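(* Let $\mathscr{K}$ be an essentially small rigid tt-category and let $\{F_i\colon\mathscr{K}\to\mathscr{L}_i\}_{i\in I}$ be a family of tt-functors to essentially small tt-categories that jointly detects $\otimes$-nilpotence, i.e. every morphism $f$ in $\mathscr{K}$ such that $F_i(f)$ is $\otimes$-nilpotent for all $i\in I$ is itself $\otimes$-nilpotent. Then the subset $\bigcup_{i\in I}\mathrm{Im}(\mathrm{Spc}(F_i))\subseteq\mathrm{Spc}(\mathscr{K})$ is patch-dense.
   Context: A tt-category is a triangulated category with a symmetric monoidal structure $(\otimes,\mathbb{1})$ such that $\otimes$ is exact in each variable; it is rigid if every object has a dual (every object is strongly dualizable). A tt-functor is an exact (strong) symmetric monoidal functor. A tt-ideal is a thick triangulated subcategory (closed under direct summands) that is closed under tensoring with arbitrary objects; a proper tt-ideal $\mathscr{P}$ is prime if $k\otimes\ell\in\mathscr{P}$ implies $k\in\mathscr{P}$ or $\ell\in\mathscr{P}$. For $\mathscr{K}$ essentially small, the spectrum $\mathrm{Spc}(\mathscr{K})$ is the set of prime tt-ideals of $\mathscr{K}$, with the topology having as a basis of closed subsets the sets $\mathrm{supp}(k)=\{\mathscr{P} : k\notin\mathscr{P}\}$, $k\in\mathscr{K}$; it is a spectral space whose quasi-compact opens are exactly the complements $\mathrm{supp}(k)^c$. A tt-functor $F\colon\mathscr{K}\to\mathscr{L}$ induces $\mathrm{Spc}(F)\colon\mathrm{Spc}(\mathscr{L})\to\mathrm{Spc}(\mathscr{K})$, $\mathscr{Q}\mapsto F^{-1}(\mathscr{Q})$.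 The constructible (or patch) topology on a spectral space is the topology generated by the quasi-compact open subsets and their complements. A subset is patch-dense if it is dense for this topology. A morphism $f\colon k\to\ell$ is $\otimes$-nilpotent if $f^{\otimes s}\colon k^{\otimes s}\to\ell^{\otimes s}$ is zero for $s\gg0$. *)

theory Defs
  imports "HOL-Algebra.Group" "HOL-Analysis.Abstract_Topology"
begin

section \<open>Categories, functors and natural isomorphisms\<close>

text \<open>
  Categories are records with explicit carriers. Objects and arrows live in HOL types,
  hence form sets: every category below is small, and conversely an essentially small category is
  represented by a small category equivalent to it. All axioms are relativised to the carriers;
  the operations are arbitrary outside of them.
\<close>

record ('o, 'm) category =
  Obj :: "'o set"
  Arr :: "'m set"
  Dom :: "'m \<Rightarrow> 'o"
  Cod :: "'m \<Rightarrow> 'o"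
  Id :: "'o \<Rightarrow> 'm"
  Comp :: "'m \<Rightarrow> 'm \<Rightarrow> 'm" (infixr "\<cdot>\<index>" 55)

definition Hom :: "('o, 'm, 'x) category_scheme \<Rightarrow> 'o \<Rightarrow> 'o \<Rightarrow> 'm set" where
  "Hom C a b = {f \<in> Arr C. Dom C f = a \<and> Cod C f = b}"

locale category =
  fixes C :: "('o, 'm, 'x) category_scheme" (structure)
  assumes Dom_closed: "f \<in> Arr C \<Longrightarrow> Dom C f \<in> Obj C"
    and Cod_closed: "f \<in> Arr C \<Longrightarrow> Cod C f \<in> Obj C"
    and Id_closed: "a \<in> Obj C \<Longrightarrow> Id C a \<in> Hom C a a"
    and Comp_closed: "\<lbrakk>f \<in> Hom C a b; g \<in> Hom C b c\<rbrakk> \<Longrightarrow> g \<cdot> f \<in> Hom C a c"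
    and Comp_Id: "f \<in> Hom C a b \<Longrightarrow> f \<cdot> Id C a = f"
    and Id_Comp: "f \<in> Hom C a b \<Longrightarrow> Id C b \<cdot> f = f"
    and Comp_assoc:
      "\<lbrakk>f \<in> Hom C a b; g \<in> Hom C b c; h \<in> Hom C c d\<rbrakk> \<Longrightarrow> (h \<cdot> g) \<cdot> f = h \<cdot> (g \<cdot> f)"

definition inverse_arrows :: "('o, 'm, 'x) category_scheme \<Rightarrow> 'm \<Rightarrow> 'm \<Rightarrow> bool" where
  "inverse_arrows C f g \<longleftrightarrow>
     f \<in> Arr C \<and> g \<in> Hom C (Cod C f) (Dom C f) \<and>
     g \<cdot>\<^bsub>C\<^esub> f = Id C (Dom C f) \<and> f \<cdot>\<^bsub>C\<^esub> g = Id C (Cod C f)"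

definition is_iso :: "('o, 'm, 'x) category_scheme \<Rightarrow> 'm \<Rightarrow> bool" where
  "is_iso C f \<longleftrightarrow> (\<exists>g. inverse_arrows C f g)"

definition Inv :: "('o, 'm, 'x) category_scheme \<Rightarrow> 'm \<Rightarrow> 'm" where
  "Inv C f = (THE g. inverse_arrows C f g)"

definition isomorphic :: "('o, 'm, 'x) category_scheme \<Rightarrow> 'o \<Rightarrow> 'o \<Rightarrow> bool" where
  "isomorphic C a b \<longleftrightarrow> (\<exists>f \<in> Hom C a b. is_iso C f)"

record ('o, 'm, 'p, 'n) func =
  omap :: "'o \<Rightarrow> 'p"
  amap :: "'m \<Rightarrow> 'n"

definition is_functor ::
  "('o, 'm, 'x) category_scheme \<Rightarrow> ('p, 'n, 'y) category_scheme \<Rightarrow>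
   ('o, 'm, 'p, 'n, 'z) func_scheme \<Rightarrow> bool" where
  "is_functor C D F \<longleftrightarrow>
     (\<forall>a \<in> Obj C. omap F a \<in> Obj D) \<and>
     (\<forall>f \<in> Arr C. amap F f \<in> Hom D (omap F (Dom C f)) (omap F (Cod C f))) \<and>
     (\<forall>a \<in> Obj C. amap F (Id C a) = Id D (omap F a)) \<and>
     (\<forall>f \<in> Arr C. \<forall>g \<in> Arr C. Dom C g = Cod C f \<longrightarrow>
        amap F (g \<cdot>\<^bsub>C\<^esub> f) = amap F g \<cdot>\<^bsub>D\<^esub> amap F f)"

definition id_func :: "('o, 'm, 'o, 'm) func" where
  "id_func = \<lparr>omap = \<lambda>a. a, amap = \<lambda>f. f\<rparr>"

definition comp_func ::
  "('p, 'n, 'q, 'k, 'x) func_scheme \<Rightarrow> ('o, 'm, 'p, 'n, 'y) func_scheme \<Rightarrow>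
   ('o, 'm, 'q, 'k) func" where
  "comp_func G F = \<lparr>omap = \<lambda>a. omap G (omap F a), amap = \<lambda>f. amap G (amap F f)\<rparr>"

definition natural_iso ::
  "('o, 'm, 'x) category_scheme \<Rightarrow> ('p, 'n, 'y) category_scheme \<Rightarrow>
   ('o, 'm, 'p, 'n, 'u) func_scheme \<Rightarrow> ('o, 'm, 'p, 'n, 'v) func_scheme \<Rightarrow>
   ('o \<Rightarrow> 'n) \<Rightarrow> bool" where
  "natural_iso C D F G \<phi> \<longleftrightarrow>
     (\<forall>a \<in> Obj C. \<phi> a \<in> Hom D (omap F a) (omap G a) \<and> is_iso D (\<phi> a)) \<and>
     (\<forall>f \<in> Arr C. \<phi> (Cod C f) \<cdot>\<^bsub>D\<^esub> amap F f = amap G f \<cdot>\<^bsub>D\<^esub> \<phi> (Dom C f))"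

definition is_equivalence ::
  "('o, 'm, 'x) category_scheme \<Rightarrow> ('p, 'n, 'y) category_scheme \<Rightarrow>
   ('o, 'm, 'p, 'n, 'z) func_scheme \<Rightarrow> bool" where
  "is_equivalence C D F \<longleftrightarrow> is_functor C D F \<and>
     (\<exists>G :: ('p, 'n, 'o, 'm) func. is_functor D C G \<and>
        (\<exists>\<eta>. natural_iso C C id_func (comp_func G F) \<eta>) \<and>
        (\<exists>\<epsilon>. natural_iso D D (comp_func F G) id_func \<epsilon>))"


section \<open>Additive categories\<close>

record ('o, 'm) add_cat = "('o, 'm) category" +
  Plus :: "'m \<Rightarrow> 'm \<Rightarrow> 'm"
  Zer :: "'o \<Rightarrow> 'o \<Rightarrow> 'm"

definition hom_group :: "('o, 'm, 'x) add_cat_scheme \<Rightarrow> 'o \<Rightarrow> 'o \<Rightarrow> 'm monoid" where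
  "hom_group C a b = \<lparr>carrier = Hom C a b, monoid.mult = Plus C, one = Zer C a b\<rparr>"

definition Neg :: "('o, 'm, 'x) add_cat_scheme \<Rightarrow> 'm \<Rightarrow> 'm" where
  "Neg C f = m_inv (hom_group C (Dom C f) (Cod C f)) f"

definition zero_object :: "('o, 'm, 'x) category_scheme \<Rightarrow> 'o \<Rightarrow> bool" where
  "zero_object C z \<longleftrightarrow> z \<in> Obj C \<and>
     (\<forall>a \<in> Obj C. (\<exists>!f. f \<in> Hom C z a) \<and> (\<exists>!f. f \<in> Hom C a z))"

definition biproduct :: "('o, 'm, 'x) add_cat_scheme \<Rightarrow> 'o \<Rightarrow> 'o \<Rightarrow> 'o \<Rightarrow> bool" where
  "biproduct C a b c \<longleftrightarrow> a \<in> Obj C \<and> b \<in> Obj C \<and> c \<in> Obj C \<and>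
     (\<exists>i \<in> Hom C a c. \<exists>j \<in> Hom C b c. \<exists>p \<in> Hom C c a. \<exists>q \<in> Hom C c b.
        p \<cdot>\<^bsub>C\<^esub> i = Id C a \<and> q \<cdot>\<^bsub>C\<^esub> j = Id C b \<and>
        p \<cdot>\<^bsub>C\<^esub> j = Zer C b a \<and> q \<cdot>\<^bsub>C\<^esub> i = Zer C a b \<and>
        Plus C (i \<cdot>\<^bsub>C\<^esub> p) (j \<cdot>\<^bsub>C\<^esub> q) = Id C c)"

locale additive_category = category C
  for C :: "('o, 'm, 'x) add_cat_scheme" (structure) +
  assumes hom_group: "\<lbrakk>a \<in> Obj C; b \<in> Obj C\<rbrakk> \<Longrightarrow> comm_group (hom_group C a b)"
    and Comp_Plus:
      "\<lbrakk>f \<in> Hom C a b; f' \<in> Hom C a b; g \<in> Hom C b c\<rbrakk>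
       \<Longrightarrow> g \<cdot> Plus C f f' = Plus C (g \<cdot> f) (g \<cdot> f')"
    and Plus_Comp:
      "\<lbrakk>f \<in> Hom C a b; g \<in> Hom C b c; g' \<in> Hom C b c\<rbrakk>
       \<Longrightarrow> Plus C g g' \<cdot> f = Plus C (g \<cdot> f) (g' \<cdot> f)"
    and ex_zero_object: "\<exists>z. zero_object C z"
    and ex_biproduct: "\<lbrakk>a \<in> Obj C; b \<in> Obj C\<rbrakk> \<Longrightarrow> \<exists>c. biproduct C a b c"

definition additive_functor ::
  "('o, 'm, 'x) add_cat_scheme \<Rightarrow> ('p, 'n, 'y) add_cat_scheme \<Rightarrow>
   ('o, 'm, 'p, 'n, 'z) func_scheme \<Rightarrow> bool" where
  "additive_functor C D F \<longleftrightarrow> is_functor C D F \<and>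
     (\<forall>f \<in> Arr C. \<forall>g \<in> Hom C (Dom C f) (Cod C f).
        amap F (Plus C f g) = Plus D (amap F f) (amap F g))"


section \<open>Triangulated categories\<close>

text \<open>
  A triple \<open>(f, g, h)\<close> encodes the triangle \<open>a \<rightarrow> b \<rightarrow> c \<rightarrow> \<Sigma>a\<close>. The suspension is an additive
  auto-equivalence, not necessarily an automorphism.
\<close>

record ('o, 'm) tri_cat = "('o, 'm) add_cat" +
  Shift :: "('o, 'm, 'o, 'm) func"
  Tri :: "('m \<times> 'm \<times> 'm) set"

definition triangle :: "('o, 'm, 'x) tri_cat_scheme \<Rightarrow> 'm \<Rightarrow> 'm \<Rightarrow> 'm \<Rightarrow> bool" where
  "triangle C f g h \<longleftrightarrow> f \<in> Arr C \<and> g \<in> Arr C \<and> h \<in> Arr C \<and>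
     Dom C g = Cod C f \<and> Dom C h = Cod C g \<and> Cod C h = omap (Shift C) (Dom C f)"

text \<open>Verdier's axioms, the last one being the octahedral axiom.\<close>

locale triangulated_category = additive_category C
  for C :: "('o, 'm, 'x) tri_cat_scheme" (structure) +
  assumes Shift_additive: "additive_functor C C (Shift C)"
    and Shift_equivalence: "is_equivalence C C (Shift C)"
    and Tri_triangle: "(f, g, h) \<in> Tri C \<Longrightarrow> triangle C f g h"
    and Tri_iso:
      "\<lbrakk>(f, g, h) \<in> Tri C; triangle C f' g' h';
        u \<in> Hom C (Dom C f) (Dom C f'); v \<in> Hom C (Cod C f) (Cod C f');
        w \<in> Hom C (Cod C g) (Cod C g'); is_iso C u; is_iso C v; is_iso C w;
        v \<cdot> f = f' \<cdot> u; w \<cdot> g = g' \<cdot> v; amap (Shift C) u \<cdot> h = h' \<cdot> w\<rbrakk>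
       \<Longrightarrow> (f', g', h') \<in> Tri C"
    and Tri_Id:
      "\<lbrakk>a \<in> Obj C; zero_object C z\<rbrakk>
       \<Longrightarrow> (Id C a, Zer C a z, Zer C z (omap (Shift C) a)) \<in> Tri C"
    and Tri_cone: "f \<in> Arr C \<Longrightarrow> \<exists>g h. (f, g, h) \<in> Tri C"
    and Tri_rotate:
      "triangle C f g h \<Longrightarrow>
       (f, g, h) \<in> Tri C \<longleftrightarrow> (g, h, Neg C (amap (Shift C) f)) \<in> Tri C"
    and Tri_morphism:
      "\<lbrakk>(f, g, h) \<in> Tri C; (f', g', h') \<in> Tri C;
        u \<in> Hom C (Dom C f) (Dom C f'); v \<in> Hom C (Cod C f) (Cod C f'); v \<cdot> f = f' \<cdot> u\<rbrakk>
       \<Longrightarrow> \<exists>w \<in> Hom C (Cod C g) (Cod C g').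
             w \<cdot> g = g' \<cdot> v \<and> amap (Shift C) u \<cdot> h = h' \<cdot> w"
    and Tri_octahedron:
      "\<lbrakk>(f, f', f'') \<in> Tri C; (g, g', g'') \<in> Tri C; Dom C g = Cod C f;
        (g \<cdot> f, k', k'') \<in> Tri C\<rbrakk>
       \<Longrightarrow> \<exists>u \<in> Hom C (Cod C f') (Cod C k'). \<exists>v \<in> Hom C (Cod C k') (Cod C g').
             (u, v, amap (Shift C) f' \<cdot> g'') \<in> Tri C \<and>
             u \<cdot> f' = k' \<cdot> g \<and> k'' \<cdot> u = f'' \<and>
             v \<cdot> k' = g' \<and> g'' \<cdot> v = amap (Shift C) f \<cdot> k''"

definition exact_functor ::
  "('o, 'm, 'x) tri_cat_scheme \<Rightarrow> ('p, 'n, 'y) tri_cat_scheme \<Rightarrow>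
   ('o, 'm, 'p, 'n, 'z) func_scheme \<Rightarrow> bool" where
  "exact_functor C D F \<longleftrightarrow> additive_functor C D F \<and>
     (\<exists>\<phi>. natural_iso C D (comp_func F (Shift C)) (comp_func (Shift D) F) \<phi> \<and>
        (\<forall>f g h. (f, g, h) \<in> Tri C \<longrightarrow>
           (amap F f, amap F g, \<phi> (Dom C f) \<cdot>\<^bsub>D\<^esub> amap F h) \<in> Tri D))"

definition thick_subcategory :: "('o, 'm, 'x) tri_cat_scheme \<Rightarrow> 'o set \<Rightarrow> bool" where
  "thick_subcategory C J \<longleftrightarrow> J \<subseteq> Obj C \<and>
     (\<forall>z. zero_object C z \<longrightarrow> z \<in> J) \<and>
     (\<forall>a \<in> J. \<forall>b \<in> Obj C. isomorphic C a b \<longrightarrow> b \<in> J) \<and>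
     (\<forall>a \<in> Obj C. omap (Shift C) a \<in> J \<longleftrightarrow> a \<in> J) \<and>
     (\<forall>f g h. (f, g, h) \<in> Tri C \<longrightarrow> Dom C f \<in> J \<longrightarrow> Cod C f \<in> J \<longrightarrow> Cod C g \<in> J) \<and>
     (\<forall>a b c. biproduct C a b c \<longrightarrow> c \<in> J \<longrightarrow> a \<in> J \<and> b \<in> J)"


section \<open>tt-categories and tt-functors\<close>

record ('o, 'm) tt_cat = "('o, 'm) tri_cat" +
  TObj :: "'o \<Rightarrow> 'o \<Rightarrow> 'o" (infixr "\<otimes>\<^sub>o\<index>" 70)
  TArr :: "'m \<Rightarrow> 'm \<Rightarrow> 'm" (infixr "\<otimes>\<^sub>a\<index>" 70)
  Unit :: "'o"
  assoc :: "'o \<Rightarrow> 'o \<Rightarrow> 'o \<Rightarrow> 'm"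
  lunit :: "'o \<Rightarrow> 'm"
  runit :: "'o \<Rightarrow> 'm"
  braid :: "'o \<Rightarrow> 'o \<Rightarrow> 'm"

locale symmetric_monoidal_category = category C
  for C :: "('o, 'm, 'x) tt_cat_scheme" (structure) +
  assumes TObj_closed: "\<lbrakk>a \<in> Obj C; b \<in> Obj C\<rbrakk> \<Longrightarrow> a \<otimes>\<^sub>o b \<in> Obj C"
    and TArr_closed:
      "\<lbrakk>f \<in> Hom C a b; g \<in> Hom C c d\<rbrakk> \<Longrightarrow> f \<otimes>\<^sub>a g \<in> Hom C (a \<otimes>\<^sub>o c) (b \<otimes>\<^sub>o d)"
    and TArr_Id: "\<lbrakk>a \<in> Obj C; b \<in> Obj C\<rbrakk> \<Longrightarrow> Id C a \<otimes>\<^sub>a Id C b = Id C (a \<otimes>\<^sub>o b)"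
    and TArr_Comp:
      "\<lbrakk>f \<in> Hom C a b; g \<in> Hom C b c; f' \<in> Hom C a' b'; g' \<in> Hom C b' c'\<rbrakk>
       \<Longrightarrow> (g \<cdot> f) \<otimes>\<^sub>a (g' \<cdot> f') = (g \<otimes>\<^sub>a g') \<cdot> (f \<otimes>\<^sub>a f')"
    and Unit_closed: "Unit C \<in> Obj C"
    and assoc_closed:
      "\<lbrakk>a \<in> Obj C; b \<in> Obj C; c \<in> Obj C\<rbrakk>
       \<Longrightarrow> assoc C a b c \<in> Hom C ((a \<otimes>\<^sub>o b) \<otimes>\<^sub>o c) (a \<otimes>\<^sub>o (b \<otimes>\<^sub>o c)) \<and> is_iso C (assoc C a b c)"
    and assoc_natural:
      "\<lbrakk>f \<in> Hom C a a'; g \<in> Hom C b b'; h \<in> Hom C c c'\<rbrakk>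
       \<Longrightarrow> assoc C a' b' c' \<cdot> ((f \<otimes>\<^sub>a g) \<otimes>\<^sub>a h) = (f \<otimes>\<^sub>a (g \<otimes>\<^sub>a h)) \<cdot> assoc C a b c"
    and lunit_closed:
      "a \<in> Obj C \<Longrightarrow> lunit C a \<in> Hom C (Unit C \<otimes>\<^sub>o a) a \<and> is_iso C (lunit C a)"
    and lunit_natural:
      "f \<in> Hom C a b \<Longrightarrow> lunit C b \<cdot> (Id C (Unit C) \<otimes>\<^sub>a f) = f \<cdot> lunit C a"
    and runit_closed:
      "a \<in> Obj C \<Longrightarrow> runit C a \<in> Hom C (a \<otimes>\<^sub>o Unit C) a \<and> is_iso C (runit C a)"
    and runit_natural:
      "f \<in> Hom C a b \<Longrightarrow> runit C b \<cdot> (f \<otimes>\<^sub>a Id C (Unit C)) = f \<cdot> runit C a"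
    and braid_closed:
      "\<lbrakk>a \<in> Obj C; b \<in> Obj C\<rbrakk> \<Longrightarrow> braid C a b \<in> Hom C (a \<otimes>\<^sub>o b) (b \<otimes>\<^sub>o a)"
    and braid_natural:
      "\<lbrakk>f \<in> Hom C a a'; g \<in> Hom C b b'\<rbrakk>
       \<Longrightarrow> braid C a' b' \<cdot> (f \<otimes>\<^sub>a g) = (g \<otimes>\<^sub>a f) \<cdot> braid C a b"
    and pentagon:
      "\<lbrakk>a \<in> Obj C; b \<in> Obj C; c \<in> Obj C; d \<in> Obj C\<rbrakk>
       \<Longrightarrow> assoc C a b (c \<otimes>\<^sub>o d) \<cdot> assoc C (a \<otimes>\<^sub>o b) c d =
           (Id C a \<otimes>\<^sub>a assoc C b c d) \<cdot> assoc C a (b \<otimes>\<^sub>o c) d \<cdot> (assoc C a b c \<otimes>\<^sub>a Id C d)"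
    and unit_triangle:
      "\<lbrakk>a \<in> Obj C; b \<in> Obj C\<rbrakk>
       \<Longrightarrow> (Id C a \<otimes>\<^sub>a lunit C b) \<cdot> assoc C a (Unit C) b = runit C a \<otimes>\<^sub>a Id C b"
    and hexagon:
      "\<lbrakk>a \<in> Obj C; b \<in> Obj C; c \<in> Obj C\<rbrakk>
       \<Longrightarrow> assoc C b c a \<cdot> braid C a (b \<otimes>\<^sub>o c) \<cdot> assoc C a b c =
           (Id C b \<otimes>\<^sub>a braid C a c) \<cdot> assoc C b a c \<cdot> (braid C a b \<otimes>\<^sub>a Id C c)"
    and braid_braid:
      "\<lbrakk>a \<in> Obj C; b \<in> Obj C\<rbrakk> \<Longrightarrow> braid C b a \<cdot> braid C a b = Id C (a \<otimes>\<^sub>o b)"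

definition tensor_left :: "('o, 'm, 'x) tt_cat_scheme \<Rightarrow> 'o \<Rightarrow> ('o, 'm, 'o, 'm) func" where
  "tensor_left C a = \<lparr>omap = \<lambda>b. a \<otimes>\<^sub>o\<^bsub>C\<^esub> b, amap = \<lambda>f. Id C a \<otimes>\<^sub>a\<^bsub>C\<^esub> f\<rparr>"

definition tensor_right :: "('o, 'm, 'x) tt_cat_scheme \<Rightarrow> 'o \<Rightarrow> ('o, 'm, 'o, 'm) func" where
  "tensor_right C b = \<lparr>omap = \<lambda>a. a \<otimes>\<^sub>o\<^bsub>C\<^esub> b, amap = \<lambda>f. f \<otimes>\<^sub>a\<^bsub>C\<^esub> Id C b\<rparr>"

locale tt_category = triangulated_category C + symmetric_monoidal_category C
  for C :: "('o, 'm, 'x) tt_cat_scheme" (structure) +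
  assumes tensor_left_exact: "a \<in> Obj C \<Longrightarrow> exact_functor C C (tensor_left C a)"
    and tensor_right_exact: "a \<in> Obj C \<Longrightarrow> exact_functor C C (tensor_right C a)"

text \<open>Duality data: the two composites \<open>a \<rightarrow> a\<close> and \<open>d \<rightarrow> d\<close> are the zig-zag identities.\<close>

definition is_dual :: "('o, 'm, 'x) tt_cat_scheme \<Rightarrow> 'o \<Rightarrow> 'o \<Rightarrow> bool" where
  "is_dual C a d \<longleftrightarrow> a \<in> Obj C \<and> d \<in> Obj C \<and>
     (\<exists>ev \<in> Hom C (d \<otimes>\<^sub>o\<^bsub>C\<^esub> a) (Unit C). \<exists>coev \<in> Hom C (Unit C) (a \<otimes>\<^sub>o\<^bsub>C\<^esub> d).
        runit C a \<cdot>\<^bsub>C\<^esub> (Id C a \<otimes>\<^sub>a\<^bsub>C\<^esub> ev) \<cdot>\<^bsub>C\<^esub> assoc C a d a \<cdot>\<^bsub>C\<^esub>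
          (coev \<otimes>\<^sub>a\<^bsub>C\<^esub> Id C a) \<cdot>\<^bsub>C\<^esub> Inv C (lunit C a) = Id C a \<and>
        lunit C d \<cdot>\<^bsub>C\<^esub> (ev \<otimes>\<^sub>a\<^bsub>C\<^esub> Id C d) \<cdot>\<^bsub>C\<^esub> Inv C (assoc C d a d) \<cdot>\<^bsub>C\<^esub>
          (Id C d \<otimes>\<^sub>a\<^bsub>C\<^esub> coev) \<cdot>\<^bsub>C\<^esub> Inv C (runit C d) = Id C d)"

definition rigid :: "('o, 'm, 'x) tt_cat_scheme \<Rightarrow> bool" where
  "rigid C \<longleftrightarrow> (\<forall>a \<in> Obj C. \<exists>d. is_dual C a d)"

text \<open>The structure isomorphisms are \<open>F a \<otimes> F b \<rightarrow> F (a \<otimes> b)\<close> and \<open>1 \<rightarrow> F 1\<close>.\<close>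

record ('o, 'm, 'p, 'n) monoidal_func = "('o, 'm, 'p, 'n) func" +
  mu :: "'o \<Rightarrow> 'o \<Rightarrow> 'n"
  eps :: "'n"

definition symmetric_monoidal_functor ::
  "('o, 'm, 'x) tt_cat_scheme \<Rightarrow> ('p, 'n, 'y) tt_cat_scheme \<Rightarrow>
   ('o, 'm, 'p, 'n, 'z) monoidal_func_scheme \<Rightarrow> bool" where
  "symmetric_monoidal_functor C D F \<longleftrightarrow> is_functor C D F \<and>
     (\<forall>a \<in> Obj C. \<forall>b \<in> Obj C.
        mu F a b \<in> Hom D (omap F a \<otimes>\<^sub>o\<^bsub>D\<^esub> omap F b) (omap F (a \<otimes>\<^sub>o\<^bsub>C\<^esub> b)) \<and> is_iso D (mu F a b)) \<and>
     (\<forall>f \<in> Arr C. \<forall>g \<in> Arr C.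
        mu F (Cod C f) (Cod C g) \<cdot>\<^bsub>D\<^esub> (amap F f \<otimes>\<^sub>a\<^bsub>D\<^esub> amap F g) =
        amap F (f \<otimes>\<^sub>a\<^bsub>C\<^esub> g) \<cdot>\<^bsub>D\<^esub> mu F (Dom C f) (Dom C g)) \<and>
     eps F \<in> Hom D (Unit D) (omap F (Unit C)) \<and> is_iso D (eps F) \<and>
     (\<forall>a \<in> Obj C. \<forall>b \<in> Obj C. \<forall>c \<in> Obj C.
        amap F (assoc C a b c) \<cdot>\<^bsub>D\<^esub> mu F (a \<otimes>\<^sub>o\<^bsub>C\<^esub> b) c \<cdot>\<^bsub>D\<^esub>
          (mu F a b \<otimes>\<^sub>a\<^bsub>D\<^esub> Id D (omap F c)) =
        mu F a (b \<otimes>\<^sub>o\<^bsub>C\<^esub> c) \<cdot>\<^bsub>D\<^esub> (Id D (omap F a) \<otimes>\<^sub>a\<^bsub>D\<^esub> mu F b c) \<cdot>\<^bsub>D\<^esub>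
          assoc D (omap F a) (omap F b) (omap F c)) \<and>
     (\<forall>a \<in> Obj C.
        amap F (lunit C a) \<cdot>\<^bsub>D\<^esub> mu F (Unit C) a \<cdot>\<^bsub>D\<^esub> (eps F \<otimes>\<^sub>a\<^bsub>D\<^esub> Id D (omap F a)) =
        lunit D (omap F a)) \<and>
     (\<forall>a \<in> Obj C.
        amap F (runit C a) \<cdot>\<^bsub>D\<^esub> mu F a (Unit C) \<cdot>\<^bsub>D\<^esub> (Id D (omap F a) \<otimes>\<^sub>a\<^bsub>D\<^esub> eps F) =
        runit D (omap F a)) \<and>
     (\<forall>a \<in> Obj C. \<forall>b \<in> Obj C.
        amap F (braid C a b) \<cdot>\<^bsub>D\<^esub> mu F a b =
        mu F b a \<cdot>\<^bsub>D\<^esub> braid D (omap F a) (omap F b))"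

definition tt_functor ::
  "('o, 'm, 'x) tt_cat_scheme \<Rightarrow> ('p, 'n, 'y) tt_cat_scheme \<Rightarrow>
   ('o, 'm, 'p, 'n, 'z) monoidal_func_scheme \<Rightarrow> bool" where
  "tt_functor C D F \<longleftrightarrow> exact_functor C D F \<and> symmetric_monoidal_functor C D F"


section \<open>Tensor-nilpotence\<close>

primrec tpow_obj :: "('o, 'm, 'x) tt_cat_scheme \<Rightarrow> 'o \<Rightarrow> nat \<Rightarrow> 'o" where
  "tpow_obj C a 0 = Unit C"
| "tpow_obj C a (Suc s) = a \<otimes>\<^sub>o\<^bsub>C\<^esub> tpow_obj C a s"

primrec tpow :: "('o, 'm, 'x) tt_cat_scheme \<Rightarrow> 'm \<Rightarrow> nat \<Rightarrow> 'm" where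
  "tpow C f 0 = Id C (Unit C)"
| "tpow C f (Suc s) = f \<otimes>\<^sub>a\<^bsub>C\<^esub> tpow C f s"

definition tensor_nilpotent :: "('o, 'm, 'x) tt_cat_scheme \<Rightarrow> 'm \<Rightarrow> bool" where
  "tensor_nilpotent C f \<longleftrightarrow>
     (\<exists>N. \<forall>s \<ge> N. tpow C f s = Zer C (tpow_obj C (Dom C f) s) (tpow_obj C (Cod C f) s))"

definition jointly_detects_tensor_nilpotence ::
  "'i set \<Rightarrow> ('o, 'm, 'x) tt_cat_scheme \<Rightarrow> ('i \<Rightarrow> ('p, 'n, 'y) tt_cat_scheme) \<Rightarrow>
   ('i \<Rightarrow> ('o, 'm, 'p, 'n, 'z) func_scheme) \<Rightarrow> bool" where
  "jointly_detects_tensor_nilpotence I K L F \<longleftrightarrow>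
     (\<forall>f \<in> Arr K. (\<forall>i \<in> I. tensor_nilpotent (L i) (amap (F i) f)) \<longrightarrow> tensor_nilpotent K f)"


section \<open>The spectrum\<close>

definition tt_ideal :: "('o, 'm, 'x) tt_cat_scheme \<Rightarrow> 'o set \<Rightarrow> bool" where
  "tt_ideal C J \<longleftrightarrow> thick_subcategory C J \<and>
     (\<forall>a \<in> J. \<forall>b \<in> Obj C. a \<otimes>\<^sub>o\<^bsub>C\<^esub> b \<in> J \<and> b \<otimes>\<^sub>o\<^bsub>C\<^esub> a \<in> J)"

definition prime_tt_ideal :: "('o, 'm, 'x) tt_cat_scheme \<Rightarrow> 'o set \<Rightarrow> bool" where
  "prime_tt_ideal C P \<longleftrightarrow> tt_ideal C P \<and> P \<noteq> Obj C \<and>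
     (\<forall>k \<in> Obj C. \<forall>l \<in> Obj C. k \<otimes>\<^sub>o\<^bsub>C\<^esub> l \<in> P \<longrightarrow> k \<in> P \<or> l \<in> P)"

definition supp :: "('o, 'm, 'x) tt_cat_scheme \<Rightarrow> 'o \<Rightarrow> 'o set set" where
  "supp C k = {P. prime_tt_ideal C P \<and> k \<notin> P}"

text \<open>
  The complements of the supports are closed under finite intersections
  (\<open>supp k \<union> supp l = supp (k \<oplus> l)\<close>), so the topology they generate is the one having
  the supports as a basis of closed sets.
\<close>

definition Spc :: "('o, 'm, 'x) tt_cat_scheme \<Rightarrow> 'o set topology" where
  "Spc C = topology_generated_by {{P. prime_tt_ideal C P} - supp C k | k. k \<in> Obj C}"

lemma (in tt_category) topspace_Spc: "topspace (Spc C) = {P. prime_tt_ideal C P}"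
proof -
  obtain z where z: "zero_object C z" using ex_zero_object by blast
  have "supp C z = {}"
    using z by (auto simp: supp_def prime_tt_ideal_def tt_ideal_def thick_subcategory_def)
  moreover have "z \<in> Obj C" using z by (simp add: zero_object_def)
  ultimately have "{P. prime_tt_ideal C P} \<in> {{P. prime_tt_ideal C P} - supp C k | k. k \<in> Obj C}"
    by (metis (mono_tags, lifting) Diff_empty mem_Collect_eq)
  then show ?thesis by (auto simp: Spc_def topology_generated_by_topspace)
qed

definition Spc_map ::
  "('o, 'm, 'x) tt_cat_scheme \<Rightarrow> ('o, 'm, 'p, 'n, 'z) func_scheme \<Rightarrow> 'p set \<Rightarrow> 'o set" where
  "Spc_map C F Q = {k \<in> Obj C. omap F k \<in> Q}"


section \<open>The constructible topology\<close>

definition patch_topology :: "'a topology \<Rightarrow> 'a topology" where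
  "patch_topology X = topology_generated_by
     ({U. openin X U \<and> compactin X U} \<union> {topspace X - U | U. openin X U \<and> compactin X U})"

definition patch_dense :: "'a topology \<Rightarrow> 'a set \<Rightarrow> bool" where
  "patch_dense X S \<longleftrightarrow> S \<subseteq> topspace X \<and> (patch_topology X) closure_of S = topspace X"

end

theory Submission
  imports Defs
begin

text \<open>
  By compactness and primality, the sets \<open>{P. k \<in> P \<and> l \<notin> P}\<close> form a basis of the constructible
  topology, so each nonempty one has to meet the image of some \<open>Spc(F\<^sub>i)\<close>. Let \<open>h\<close> be the connecting
  morphism of the coevaluation \<open>1 \<rightarrow> k \<otimes> k\<^sup>\<or>\<close> and \<open>f = h \<otimes> l\<close>. Then \<open>f \<otimes> k = 0\<close>, and the cone of
  every power of \<open>f\<close> lies in each ideal containing \<open>k\<close>. If no prime of \<open>\<L>\<^sub>i\<close> contains \<open>F\<^sub>i k\<close> but not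
  \<open>F\<^sub>i l\<close>, then \<open>F\<^sub>i f\<close> is \<open>\<otimes>\<close>-nilpotent, since the source of \<open>f\<close> is a multiple of \<open>l\<close>. If this
  happens for all \<open>i\<close>, then some power of \<open>f\<close> vanishes; its target, a power of \<open>\<Sigma>1 \<otimes> l\<close>, is thus
  a summand of its cone, and every prime containing \<open>k\<close> contains \<open>l\<close>.

  Coherence never enters: associativity, symmetry and unit constraints are only used up to
  isomorphism in the arrow category, which preserves vanishing.
\<close>

section \<open>Isomorphisms in the arrow category\<close>

context category
begin

lemma HomD: "f \<in> Hom C a b \<Longrightarrow> f \<in> Arr C \<and> Dom C f = a \<and> Cod C f = b \<and> a \<in> Obj C \<and> b \<in> Obj C"
  using Dom_closed Cod_closed by (auto simp: Hom_def)

lemma Hom_Arr: "f \<in> Arr C \<Longrightarrow> f \<in> Hom C (Dom C f) (Cod C f)"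
  by (simp add: Hom_def)

lemma is_isoI:
  assumes "f \<in> Hom C a b" "g \<in> Hom C b a" "g \<cdot> f = Id C a" "f \<cdot> g = Id C b"
  shows "is_iso C f"
  using assms HomD[OF assms(1)] by (auto simp: is_iso_def inverse_arrows_def)

lemma is_isoE:
  assumes "is_iso C f" "f \<in> Hom C a b"
  obtains g where "g \<in> Hom C b a" "g \<cdot> f = Id C a" "f \<cdot> g = Id C b" "is_iso C g"
  using assms HomD[OF assms(2)] is_isoI[OF _ assms(2)]
  by (auto simp: is_iso_def inverse_arrows_def)

lemma Inv_iso:
  assumes "is_iso C f" "f \<in> Hom C a b"
  shows "Inv C f \<in> Hom C b a \<and> Inv C f \<cdot> f = Id C a \<and> f \<cdot> Inv C f = Id C b"
proof -
  obtain g where g: "inverse_arrows C f g" using assms(1) by (auto simp: is_iso_def)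
  have "g' = g" if g': "inverse_arrows C f g'" for g'
  proof -
    have "g \<in> Hom C b a" "g' \<in> Hom C b a" "g' \<cdot> f = Id C a" "f \<cdot> g = Id C b"
      using g g' HomD[OF assms(2)] by (auto simp: inverse_arrows_def)
    then show ?thesis using Comp_assoc[of g b a f b g' a] assms(2) Comp_Id Id_Comp by metis
  qed
  then have "inverse_arrows C f (Inv C f)"
    unfolding Inv_def using g by (metis (mono_tags, lifting) theI)
  then show ?thesis using HomD[OF assms(2)] by (auto simp: inverse_arrows_def)
qed

lemma is_iso_Id: "a \<in> Obj C \<Longrightarrow> is_iso C (Id C a)"
  using is_isoI[of "Id C a" a a "Id C a"] Id_closed Id_Comp by blast

lemma is_iso_Comp:
  assumes "f \<in> Hom C a b" "g \<in> Hom C b c" "is_iso C f" "is_iso C g"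
  shows "is_iso C (g \<cdot> f)"
proof -
  obtain f' where f': "f' \<in> Hom C b a" "f' \<cdot> f = Id C a" "f \<cdot> f' = Id C b"
    using assms is_isoE by metis
  obtain g' where g': "g' \<in> Hom C c b" "g' \<cdot> g = Id C b" "g \<cdot> g' = Id C c"
    using assms is_isoE by metis
  show ?thesis
  proof (rule is_isoI)
    show gf: "g \<cdot> f \<in> Hom C a c" and fg: "f' \<cdot> g' \<in> Hom C c a"
      using assms f' g' Comp_closed by blast+
    have "(f' \<cdot> g') \<cdot> (g \<cdot> f) = f' \<cdot> (g' \<cdot> (g \<cdot> f))" using Comp_assoc[OF gf g'(1) f'(1)] .
    also have "g' \<cdot> (g \<cdot> f) = f"
      using Comp_assoc[OF assms(1,2) g'(1)] g' Id_Comp[OF assms(1)] by simp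
    finally show "(f' \<cdot> g') \<cdot> (g \<cdot> f) = Id C a" using f' by simp
    have "(g \<cdot> f) \<cdot> (f' \<cdot> g') = g \<cdot> (f \<cdot> (f' \<cdot> g'))" using Comp_assoc[OF fg assms(1,2)] .
    also have "f \<cdot> (f' \<cdot> g') = g'"
      using Comp_assoc[OF g'(1) f'(1) assms(1)] f' Id_Comp[OF g'(1)] by simp
    finally show "(g \<cdot> f) \<cdot> (f' \<cdot> g') = Id C c" using g' by simp
  qed
qed

lemma iso_refl: "a \<in> Obj C \<Longrightarrow> isomorphic C a a"
  using Id_closed is_iso_Id by (auto simp: isomorphic_def)

lemma iso_sym: "isomorphic C a b \<Longrightarrow> isomorphic C b a"
  unfolding isomorphic_def by (blast elim: is_isoE)

lemma iso_trans [trans]: "isomorphic C a b \<Longrightarrow> isomorphic C b c \<Longrightarrow> isomorphic C a c"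
  unfolding isomorphic_def by (blast intro: is_iso_Comp Comp_closed)

lemma isoI: "f \<in> Hom C a b \<Longrightarrow> is_iso C f \<Longrightarrow> isomorphic C a b"
  by (auto simp: isomorphic_def)

end

definition arr_iso :: "('o, 'm, 'x) category_scheme \<Rightarrow> 'm \<Rightarrow> 'm \<Rightarrow> bool" where
  "arr_iso C f g \<longleftrightarrow> f \<in> Arr C \<and> g \<in> Arr C \<and>
     (\<exists>u \<in> Hom C (Dom C f) (Dom C g). \<exists>v \<in> Hom C (Cod C f) (Cod C g).
        is_iso C u \<and> is_iso C v \<and> v \<cdot>\<^bsub>C\<^esub> f = g \<cdot>\<^bsub>C\<^esub> u)"

context category
begin

lemma arr_isoI:
  assumes "f \<in> Hom C a b" "g \<in> Hom C a' b'" "u \<in> Hom C a a'" "v \<in> Hom C b b'"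
    "is_iso C u" "is_iso C v" "v \<cdot> f = g \<cdot> u"
  shows "arr_iso C f g"
  using assms HomD[OF assms(1)] HomD[OF assms(2)] by (auto simp: arr_iso_def)

lemma arr_isoE:
  assumes "arr_iso C f g"
  obtains u v a b a' b' where "f \<in> Hom C a b" "g \<in> Hom C a' b'" "u \<in> Hom C a a'"
    "v \<in> Hom C b b'" "is_iso C u" "is_iso C v" "v \<cdot> f = g \<cdot> u"
  using assms Hom_Arr unfolding arr_iso_def by blast

lemma arr_iso_refl: "f \<in> Arr C \<Longrightarrow> arr_iso C f f"
  using arr_isoI[OF Hom_Arr Hom_Arr Id_closed Id_closed is_iso_Id is_iso_Id] Dom_closed
    Cod_closed Id_Comp[OF Hom_Arr] Comp_Id[OF Hom_Arr] by simp

text \<open>Insert \<open>u \<cdot> u'\<close> to the right of \<open>g\<close>, use the square, and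
  let \<open>v'\<close> cancel \<open>v\<close>.\<close>

lemma square_inverse:
  assumes "f \<in> Hom C a b" "g \<in> Hom C a' b'" "u \<in> Hom C a a'" "v \<in> Hom C b b'"
    "v \<cdot> f = g \<cdot> u"
    "u' \<in> Hom C a' a" "v' \<in> Hom C b' b" "u \<cdot> u' = Id C a'" "v' \<cdot> v = Id C b"
  shows "v' \<cdot> g = f \<cdot> u'"
proof -
  have "v' \<cdot> g = v' \<cdot> (g \<cdot> (u \<cdot> u'))" using assms Comp_Id by simp
  also have "g \<cdot> (u \<cdot> u') = (v \<cdot> f) \<cdot> u'" using Comp_assoc[OF assms(6,3,2)] assms(5) by simp
  also have "\<dots> = v \<cdot> (f \<cdot> u')" using Comp_assoc[OF assms(6,1,4)] .
  also have "v' \<cdot> \<dots> = (v' \<cdot> v) \<cdot> (f \<cdot> u')"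
    using Comp_assoc[OF Comp_closed[OF assms(6,1)] assms(4,7)] by simp
  finally show ?thesis using assms Id_Comp Comp_closed by metis
qed

lemma square_paste:
  assumes "f \<in> Hom C a b" "g \<in> Hom C a' b'" "h \<in> Hom C a'' b''"
    "u \<in> Hom C a a'" "v \<in> Hom C b b'" "u' \<in> Hom C a' a''" "v' \<in> Hom C b' b''"
    "v \<cdot> f = g \<cdot> u" "v' \<cdot> g = h \<cdot> u'"
  shows "(v' \<cdot> v) \<cdot> f = h \<cdot> (u' \<cdot> u)"
  using Comp_assoc[OF assms(1,5,7)] Comp_assoc[OF assms(4,2,7)] Comp_assoc[OF assms(4,6,3)]
    assms(8,9) by simp

lemma arr_iso_sym:
  assumes "arr_iso C f g" shows "arr_iso C g f"
proof -
  obtain u v a b a' b' where 1: "f \<in> Hom C a b" "g \<in> Hom C a' b'" "u \<in> Hom C a a'"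
    "v \<in> Hom C b b'" "is_iso C u" "is_iso C v" "v \<cdot> f = g \<cdot> u"
    using arr_isoE[OF assms] by metis
  obtain u' where u': "u' \<in> Hom C a' a" "u \<cdot> u' = Id C a'" "is_iso C u'"
    using is_isoE[OF 1(5,3)] by metis
  obtain v' where v': "v' \<in> Hom C b' b" "v' \<cdot> v = Id C b" "is_iso C v'"
    using is_isoE[OF 1(6,4)] by metis
  show ?thesis
    using arr_isoI[OF 1(2,1) u'(1) v'(1) u'(3) v'(3)]
      square_inverse[OF 1(1-4,7) u'(1) v'(1) u'(2) v'(2)] by simp
qed

lemma arr_iso_trans [trans]:
  assumes "arr_iso C f g" "arr_iso C g h" shows "arr_iso C f h"
proof -
  obtain u v a b a' b' where 1: "f \<in> Hom C a b" "g \<in> Hom C a' b'" "u \<in> Hom C a a'"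
    "v \<in> Hom C b b'" "is_iso C u" "is_iso C v" "v \<cdot> f = g \<cdot> u"
    using arr_isoE[OF assms(1)] by metis
  obtain u' v' a'' b'' where 2: "h \<in> Hom C a'' b''" "u' \<in> Hom C a' a''"
    "v' \<in> Hom C b' b''" "is_iso C u'" "is_iso C v'" "v' \<cdot> g = h \<cdot> u'"
    using arr_isoE[OF assms(2)] 1(2) HomD by metis
  show ?thesis
    by (rule arr_isoI[OF 1(1) 2(1) Comp_closed[OF 1(3) 2(2)] Comp_closed[OF 1(4) 2(3)]
      is_iso_Comp[OF 1(3) 2(2) 1(5) 2(4)] is_iso_Comp[OF 1(4) 2(3) 1(6) 2(5)]
      square_paste[OF 1(1,2) 2(1) 1(3,4) 2(2,3) 1(7) 2(6)]])
qed

text \<open>Objects enter the arrow calculus through their identities: an isomorphism of objects can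
  replace a tensor factor of an arrow, and facts on tensor powers of arrows specialise to
  objects.\<close>

lemma arr_iso_Id_iff:
  assumes "a \<in> Obj C" "b \<in> Obj C"
  shows "arr_iso C (Id C a) (Id C b) \<longleftrightarrow> isomorphic C a b"
proof
  show "arr_iso C (Id C a) (Id C b) \<Longrightarrow> isomorphic C a b"
    using HomD[OF Id_closed[OF assms(1)]] HomD[OF Id_closed[OF assms(2)]]
    by (auto simp: arr_iso_def isomorphic_def)
  assume "isomorphic C a b"
  then obtain u where u: "u \<in> Hom C a b" "is_iso C u" by (auto simp: isomorphic_def)
  show "arr_iso C (Id C a) (Id C b)"
    using arr_isoI[OF Id_closed[OF assms(1)] Id_closed[OF assms(2)] u(1) u(1) u(2) u(2)]
      Comp_Id[OF u(1)] Id_Comp[OF u(1)] by simp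
qed

end

section \<open>Functors, arrows and isomorphisms\<close>

lemma functor_Hom: "is_functor C D F \<Longrightarrow> f \<in> Hom C a b \<Longrightarrow> amap F f \<in> Hom D (omap F a) (omap F b)"
  by (auto simp: is_functor_def Hom_def)

lemma functor_Comp:
  "is_functor C D F \<Longrightarrow> f \<in> Hom C a b \<Longrightarrow> g \<in> Hom C b c \<Longrightarrow>
   amap F (g \<cdot>\<^bsub>C\<^esub> f) = amap F g \<cdot>\<^bsub>D\<^esub> amap F f"
  by (auto simp: is_functor_def Hom_def)

lemma functor_Id: "is_functor C D F \<Longrightarrow> a \<in> Obj C \<Longrightarrow> amap F (Id C a) = Id D (omap F a)"
  by (auto simp: is_functor_def)

lemma functor_Obj: "is_functor C D F \<Longrightarrow> a \<in> Obj C \<Longrightarrow> omap F a \<in> Obj D"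
  by (auto simp: is_functor_def)

lemma functor_iso:
  assumes "category C" "category D" "is_functor C D F" "f \<in> Hom C a b" "is_iso C f"
  shows "is_iso D (amap F f)"
proof -
  obtain g where g: "g \<in> Hom C b a" "g \<cdot>\<^bsub>C\<^esub> f = Id C a" "f \<cdot>\<^bsub>C\<^esub> g = Id C b"
    by (rule category.is_isoE[OF assms(1,5,4)])
  have o: "a \<in> Obj C" "b \<in> Obj C" using category.HomD[OF assms(1,4)] by simp_all
  have "amap F g \<cdot>\<^bsub>D\<^esub> amap F f = Id D (omap F a)" "amap F f \<cdot>\<^bsub>D\<^esub> amap F g = Id D (omap F b)"
    using functor_Comp[OF assms(3,4) g(1)] functor_Comp[OF assms(3) g(1) assms(4)]
      functor_Id[OF assms(3)] g o by simp_all
  then show ?thesis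
    by (rule category.is_isoI[OF assms(2) functor_Hom[OF assms(3,4)] functor_Hom[OF assms(3) g(1)]])
qed

lemma functor_isomorphic:
  assumes "category C" "category D" "is_functor C D F" "isomorphic C a b"
  shows "isomorphic D (omap F a) (omap F b)"
  using assms(4) functor_iso[OF assms(1-3)] functor_Hom[OF assms(3)]
  unfolding isomorphic_def by blast


section \<open>Zero arrows\<close>

text \<open>A predicate that does not name source and target, so that vanishing can be transported
  along \<open>arr_iso\<close>, which changes both.\<close>

definition zero_arr :: "('o, 'm, 'x) add_cat_scheme \<Rightarrow> 'm \<Rightarrow> bool" where
  "zero_arr C f \<longleftrightarrow> f \<in> Arr C \<and> f = Zer C (Dom C f) (Cod C f)"

context additive_category
begin

lemma Zer_Hom: "a \<in> Obj C \<Longrightarrow> b \<in> Obj C \<Longrightarrow> Zer C a b \<in> Hom C a b"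
  using hom_group[of a b] comm_group.axioms(2) group.is_monoid monoid.one_closed
  by (fastforce simp: hom_group_def)

lemma zero_arr_iff: "f \<in> Hom C a b \<Longrightarrow> zero_arr C f \<longleftrightarrow> f = Zer C a b"
  using HomD[of f a b] by (auto simp: zero_arr_def)

lemma Plus_Hom: "f \<in> Hom C a b \<Longrightarrow> g \<in> Hom C a b \<Longrightarrow> Plus C f g \<in> Hom C a b"
  using hom_group[of a b] comm_group.axioms(2) group.is_monoid monoid.m_closed HomD
  by (fastforce simp: hom_group_def)

text \<open>Cancel one copy of \<open>f\<close>. Any operation that distributes over
  \<open>Plus\<close> sends 0 = 0 + 0 to such an \<open>f\<close>, and so preserves zero
  arrows.\<close>

lemma Plus_idem_zero:
  assumes "f \<in> Hom C a b" "Plus C f f = f" shows "f = Zer C a b"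
proof -
  interpret G: comm_group "hom_group C a b" using HomD[OF assms(1)] hom_group by auto
  show ?thesis using G.l_cancel_one[of f f] assms by (simp add: hom_group_def)
qed

lemma Plus_Zer:
  assumes "f \<in> Hom C a b"
  shows "Plus C f (Zer C a b) = f" "Plus C (Zer C a b) f = f"
proof -
  interpret G: comm_group "hom_group C a b" using HomD[OF assms(1)] hom_group by auto
  show "Plus C f (Zer C a b) = f" "Plus C (Zer C a b) f = f"
    using G.r_one[of f] G.l_one[of f] assms by (simp_all add: hom_group_def)
qed

lemma Neg_Hom:
  assumes "f \<in> Hom C a b"
  shows "Neg C f \<in> Hom C a b" and "Plus C f (Neg C f) = Zer C a b"
    and "Plus C (Neg C f) f = Zer C a b"
proof -
  interpret G: comm_group "hom_group C a b" using HomD[OF assms(1)] hom_group by auto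
  show "Neg C f \<in> Hom C a b" "Plus C f (Neg C f) = Zer C a b" "Plus C (Neg C f) f = Zer C a b"
    using G.inv_closed[of f] G.r_inv[of f] G.l_inv[of f] assms HomD[OF assms]
    by (simp_all add: hom_group_def Neg_def)
qed

lemma Plus_assoc:
  assumes "f \<in> Hom C a b" "g \<in> Hom C a b" "h \<in> Hom C a b"
  shows "Plus C (Plus C f g) h = Plus C f (Plus C g h)"
proof -
  interpret G: comm_group "hom_group C a b" using HomD[OF assms(1)] hom_group by auto
  show ?thesis using G.m_assoc assms by (simp add: hom_group_def)
qed

lemma Comp_Zer:
  assumes "g \<in> Hom C b c" "a \<in> Obj C" shows "g \<cdot> Zer C a b = Zer C a c"
proof -
  have z: "Zer C a b \<in> Hom C a b" using assms HomD Zer_Hom by blast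
  show ?thesis using Plus_idem_zero[OF Comp_closed[OF z assms(1)]] Comp_Plus[OF z z assms(1)]
      Plus_Zer[OF z] by simp
qed

lemma Zer_Comp:
  assumes "f \<in> Hom C a b" "c \<in> Obj C" shows "Zer C b c \<cdot> f = Zer C a c"
proof -
  have z: "Zer C b c \<in> Hom C b c" using assms HomD Zer_Hom by blast
  show ?thesis using Plus_idem_zero[OF Comp_closed[OF assms(1) z]] Plus_Comp[OF assms(1) z z]
      Plus_Zer[OF z] by simp
qed

lemma zero_arr_Zer: "a \<in> Obj C \<Longrightarrow> b \<in> Obj C \<Longrightarrow> zero_arr C (Zer C a b)"
  using Zer_Hom zero_arr_iff by blast

lemma zero_arr_Comp:
  assumes "f \<in> Hom C a b" "g \<in> Hom C b c" "zero_arr C f \<or> zero_arr C g"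
  shows "zero_arr C (g \<cdot> f)"
proof -
  have o: "a \<in> Obj C" "c \<in> Obj C" using assms HomD by blast+
  show ?thesis
    using assms(3) Comp_Zer[OF assms(2) o(1)] Zer_Comp[OF assms(1) o(2)] zero_arr_Zer[OF o]
      zero_arr_iff[OF assms(1)] zero_arr_iff[OF assms(2)] by auto
qed

lemma zero_arr_iso_cancel:
  assumes "f \<in> Hom C a b" "v \<in> Hom C b c" "is_iso C v" "zero_arr C (v \<cdot> f)"
  shows "zero_arr C f"
proof -
  obtain v' where v': "v' \<in> Hom C c b" "v' \<cdot> v = Id C b" using is_isoE[OF assms(3,2)] by metis
  have "f = v' \<cdot> (v \<cdot> f)" using Comp_assoc[OF assms(1,2) v'(1)] v' Id_Comp[OF assms(1)] by simp
  then show ?thesis using zero_arr_Comp[OF Comp_closed[OF assms(1,2)] v'(1)] assms by simp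
qed

text \<open>In the square \<open>v \<cdot> f = g \<cdot> u\<close> the right side vanishes and
  \<open>v\<close> can be cancelled.\<close>

lemma arr_iso_zero:
  assumes "arr_iso C f g" "zero_arr C g" shows "zero_arr C f"
proof -
  obtain u v a b a' b' where 1: "f \<in> Hom C a b" "g \<in> Hom C a' b'" "u \<in> Hom C a a'"
    "v \<in> Hom C b b'" "is_iso C u" "is_iso C v" "v \<cdot> f = g \<cdot> u"
    using arr_isoE[OF assms(1)] by metis
  have "zero_arr C (v \<cdot> f)" unfolding 1(7) using zero_arr_Comp[OF 1(3,2)] assms(2) by blast
  then show ?thesis by (rule zero_arr_iso_cancel[OF 1(1,4,6)])
qed

text \<open>If the identity of \<open>z\<close> vanishes, every arrow into or out of
  \<open>z\<close>, being a composite with it, vanishes too. In this form, being a zero object is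
  visibly preserved by additive functors.\<close>

lemma zero_object_iff:
  "zero_object C z \<longleftrightarrow> z \<in> Obj C \<and> zero_arr C (Id C z)"
proof
  assume z: "zero_object C z"
  then have o: "z \<in> Obj C" and e: "\<exists>!f. f \<in> Hom C z z"
    unfolding zero_object_def by simp_all
  have "Id C z = Zer C z z" using e Id_closed[OF o] Zer_Hom[OF o o] by blast
  then show "z \<in> Obj C \<and> zero_arr C (Id C z)"
    using o zero_arr_iff[OF Id_closed[OF o]] by simp
next
  assume z: "z \<in> Obj C \<and> zero_arr C (Id C z)"
  then have id: "Id C z = Zer C z z" using zero_arr_iff Id_closed by blast
  have "f = Zer C z a" if "f \<in> Hom C z a" for f a
    using that z id Comp_Id[OF that] Comp_Zer[OF that, of z] by simp
  moreover have "f = Zer C a z" if "f \<in> Hom C a z" for f a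
    using that z id Id_Comp[OF that] Zer_Comp[OF that, of z] by simp
  moreover have "Zer C z a \<in> Hom C z a" "Zer C a z \<in> Hom C a z" if "a \<in> Obj C" for a
    using z Zer_Hom that by simp_all
  ultimately have "(\<exists>!f. f \<in> Hom C z a) \<and> (\<exists>!f. f \<in> Hom C a z)" if "a \<in> Obj C" for a
    using that by (intro conjI ex1I[of _ "Zer C z a"] ex1I[of _ "Zer C a z"]) simp_all
  then show "zero_object C z" using z unfolding zero_object_def by simp
qed

lemma zero_object_Hom_eq:
  assumes "zero_object C z" "f \<in> Hom C a b" "a = z \<or> b = z" shows "f = Zer C a b"
proof -
  have o: "a \<in> Obj C" "b \<in> Obj C" using HomD[OF assms(2)] by simp_all
  have "\<exists>!f. f \<in> Hom C a b" using assms(1,3) o unfolding zero_object_def by metis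
  then show ?thesis using assms(2) Zer_Hom[OF o] by blast
qed

end

lemma additive_functor_zero:
  assumes "additive_category C" "additive_category D" "additive_functor C D F" "zero_arr C f"
  shows "zero_arr D (amap F f)"
proof -
  interpret C: additive_category C by fact
  interpret D: additive_category D by fact
  have F: "is_functor C D F" using assms(3) by (simp add: additive_functor_def)
  have f: "f \<in> Hom C (Dom C f) (Cod C f)" using assms(4) C.Hom_Arr by (auto simp: zero_arr_def)
  have "Plus C f f = f" using C.Plus_Zer[OF f] assms(4) by (metis zero_arr_def)
  moreover have "amap F (Plus C f f) = Plus D (amap F f) (amap F f)"
    using assms(3,4) f by (auto simp: additive_functor_def zero_arr_def)
  ultimately show ?thesis
    using D.Plus_idem_zero[OF functor_Hom[OF F f]] D.zero_arr_iff[OF functor_Hom[OF F f]] by simp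
qed

lemma additive_functor_zero_object:
  assumes "additive_category C" "additive_category D" "additive_functor C D F" "zero_object C z"
  shows "zero_object D (omap F z)"
proof -
  interpret C: additive_category C by fact
  interpret D: additive_category D by fact
  have F: "is_functor C D F" using assms(3) by (simp add: additive_functor_def)
  show ?thesis using assms(4) additive_functor_zero[OF assms(1-3)] functor_Id[OF F] functor_Obj[OF F]
    by (metis C.zero_object_iff D.zero_object_iff)
qed


section \<open>Triangles and thick subcategories\<close>

context triangulated_category
begin

abbreviation SO where "SO \<equiv> omap (Shift C)"
abbreviation SA where "SA \<equiv> amap (Shift C)"

lemma additive: "additive_category C" ..

lemma Shift_functor: "is_functor C C (Shift C)"
  using Shift_additive by (simp add: additive_functor_def)

lemmas SO_closed = functor_Obj[OF Shift_functor]
lemmas SA_closed = functor_Hom[OF Shift_functor]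
lemmas SA_Comp = functor_Comp[OF Shift_functor]
lemmas SA_Id = functor_Id[OF Shift_functor]

section \<open>Vanishing composites and weak cokernels in triangles\<close>

lemma TriE:
  assumes "(f, g, h) \<in> Tri C"
  obtains a b c where "f \<in> Hom C a b" "g \<in> Hom C b c" "h \<in> Hom C c (SO a)"
  using Tri_triangle[OF assms] unfolding triangle_def Hom_def by simp

lemma Tri_rot: "(f, g, h) \<in> Tri C \<Longrightarrow> (g, h, Neg C (SA f)) \<in> Tri C"
  using Tri_rotate Tri_triangle by blast

text \<open>Map the identity triangle on \<open>a\<close> to the given one by the identity of
  \<open>a\<close> and by \<open>f\<close>. The third component factors \<open>g \<cdot> f\<close>
  through a zero object.\<close>

lemma Tri_comp_zero:
  assumes T: "(f, g, h) \<in> Tri C"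
  shows "zero_arr C (g \<cdot> f)"
proof -
  obtain z where z: "zero_object C z" using ex_zero_object by blast
  obtain a b c where H: "f \<in> Hom C a b" "g \<in> Hom C b c" "h \<in> Hom C c (SO a)"
    using TriE[OF T] .
  have o: "a \<in> Obj C" "z \<in> Obj C" "c \<in> Obj C"
    using HomD[OF H(1)] HomD[OF H(2)] z by (auto simp: zero_object_def)
  note d = HomD[OF Id_closed[OF o(1)]] HomD[OF Zer_Hom[OF o(1,2)]] HomD[OF H(1)] HomD[OF H(2)]
  have "\<exists>w \<in> Hom C (Cod C (Zer C a z)) (Cod C g). w \<cdot> Zer C a z = g \<cdot> f
      \<and> SA (Id C a) \<cdot> Zer C z (SO a) = h \<cdot> w"
    using d H(1) Id_closed[OF o(1)] by (intro Tri_morphism[OF Tri_Id[OF o(1) z] T]) simp_all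
  then obtain w where w: "w \<in> Hom C z c" "w \<cdot> Zer C a z = g \<cdot> f" using d by auto
  show ?thesis
    using zero_arr_Comp[OF Zer_Hom[OF o(1,2)] w(1)] zero_arr_Zer[OF o(1,2)] w(2) by simp
qed

text \<open>One rotation gives the identity triangle on \<open>e\<close> with zero object
  \<open>SO z\<close>; the sign disappears because the last arrow starts at a zero object.\<close>

lemma Tri_zero_Id:
  assumes "e \<in> Obj C" "zero_object C z"
  shows "(Zer C z e, Id C e, Zer C e (SO z)) \<in> Tri C"
proof -
  have z: "z \<in> Obj C" "SO z \<in> Obj C" using assms SO_closed by (auto simp: zero_object_def)
  have Sz: "zero_object C (SO z)"
    by (rule additive_functor_zero_object[OF additive additive Shift_additive assms(2)])
  have H: "Zer C z e \<in> Hom C z e" "Id C e \<in> Hom C e e" "Zer C e (SO z) \<in> Hom C e (SO z)"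
    using Zer_Hom Id_closed assms(1) z by auto
  have "Neg C (SA (Zer C z e)) = Zer C (SO z) (SO e)"
    using zero_object_Hom_eq[OF Sz Neg_Hom(1)[OF SA_closed[OF H(1)]]] by simp
  then have "(Id C e, Zer C e (SO z), Neg C (SA (Zer C z e))) \<in> Tri C"
    using Tri_Id[OF assms(1) Sz] by simp
  moreover have "triangle C (Zer C z e) (Id C e) (Zer C e (SO z))"
    using HomD[OF H(1)] HomD[OF H(2)] HomD[OF H(3)] by (simp add: triangle_def)
  ultimately show ?thesis using Tri_rotate by blast
qed

text \<open>The zero arrow \<open>a \<rightarrow> z\<close> and \<open>u\<close> begin a morphism to
  the triangle of \<open>Tri_zero_Id\<close>; its third component is \<open>v\<close>.\<close>

lemma Tri_weak_cokernel:
  assumes T: "(f, g, h) \<in> Tri C" and H: "f \<in> Hom C a b" "g \<in> Hom C b c"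
    and u: "u \<in> Hom C b e" "zero_arr C (u \<cdot> f)"
  obtains v where "v \<in> Hom C c e" "u = v \<cdot> g"
proof -
  obtain z where z: "zero_object C z" using ex_zero_object by blast
  have o: "a \<in> Obj C" "e \<in> Obj C" "z \<in> Obj C"
    using HomD[OF H(1)] HomD[OF u(1)] z by (auto simp: zero_object_def)
  have Z: "Zer C a z \<in> Hom C a z" "Zer C z e \<in> Hom C z e" "Id C e \<in> Hom C e e"
    using Zer_Hom Id_closed o by auto
  note d = HomD[OF Z(1)] HomD[OF Z(2)] HomD[OF Z(3)] HomD[OF H(1)] HomD[OF H(2)] HomD[OF u(1)]
  have "u \<cdot> f = Zer C z e \<cdot> Zer C a z"
    using zero_arr_iff[OF Comp_closed[OF H(1) u(1)]] u(2) Comp_Zer[OF Z(2) o(1)] by simp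
  then have "\<exists>w \<in> Hom C (Cod C g) (Cod C (Id C e)). w \<cdot> g = Id C e \<cdot> u
      \<and> SA (Zer C a z) \<cdot> h = Zer C e (SO z) \<cdot> w"
    using d Z u by (intro Tri_morphism[OF T Tri_zero_Id[OF o(2) z]]) simp_all
  then show ?thesis using that d Id_Comp[OF u(1)] by auto
qed

text \<open>Consecutive arrows compose to zero, so \<open>SA f \<cdot> h\<close> vanishes, and
  \<open>SA r\<close> is a left inverse of \<open>SA f\<close>.\<close>

lemma Tri_split_mono_zero:
  assumes T: "(f, g, h) \<in> Tri C" and H: "f \<in> Hom C a b" "r \<in> Hom C b a" "r \<cdot> f = Id C a"
  shows "zero_arr C h"
proof -
  have a: "a \<in> Obj C" "SO a \<in> Obj C" using HomD[OF H(1)] SO_closed by auto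
  obtain c where h: "h \<in> Hom C c (SO a)"
    using TriE[OF T] HomD[OF H(1)] HomD by metis
  have Sf: "SA f \<in> Hom C (SO a) (SO b)" "SA r \<in> Hom C (SO b) (SO a)"
    using SA_closed H by auto
  have c: "c \<in> Obj C" "SO b \<in> Obj C" using HomD[OF h] HomD[OF Sf(1)] by auto
  have "zero_arr C (Neg C (SA f) \<cdot> h)"
    by (rule Tri_comp_zero[OF Tri_rot[OF Tri_rot[OF T]]])
  then have "Neg C (SA f) \<cdot> h = Zer C c (SO b)"
    using zero_arr_iff[OF Comp_closed[OF h Neg_Hom(1)[OF Sf(1)]]] by simp
  \<comment> \<open>Rotation produces the arrow with a sign. Adding \<open>SA f \<cdot> h\<close> to
    the vanishing composite removes it.\<close>
  moreover have "Plus C (Neg C (SA f) \<cdot> h) (SA f \<cdot> h) = Zer C c (SO b)"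
    using Plus_Comp[OF h Neg_Hom(1)[OF Sf(1)] Sf(1)] Neg_Hom(3)[OF Sf(1)] Zer_Comp[OF h c(2)] by simp
  ultimately have "SA f \<cdot> h = Zer C c (SO b)"
    using Plus_Zer[OF Comp_closed[OF h Sf(1)]] by simp
  then have "zero_arr C (SA f \<cdot> h)" using zero_arr_Zer[OF c] by simp
  then have "zero_arr C (SA r \<cdot> (SA f \<cdot> h))"
    using zero_arr_Comp[OF Comp_closed[OF h Sf(1)] Sf(2)] by simp
  moreover have "SA r \<cdot> (SA f \<cdot> h) = h"
    using Comp_assoc[OF h Sf] SA_Comp[OF H(1,2)] SA_Id[OF a(1)] H(3) Id_Comp[OF h] by simp
  ultimately show ?thesis by simp
qed

text \<open>The complement of a split monomorphism is its cone.\<close>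

lemma split_mono_biproduct:
  assumes g: "g \<in> Hom C b c" and v: "v \<in> Hom C c b" and vg: "v \<cdot> g = Id C b"
  obtains d where "biproduct C b d c"
proof -
  obtain q k where T: "(g, q, k) \<in> Tri C" using Tri_cone HomD[OF g] by blast
  obtain d where q: "q \<in> Hom C c d" using TriE[OF T] HomD[OF g] HomD by metis
  have k: "k \<in> Hom C d (SO b)" using TriE[OF T] HomD[OF q] HomD[OF g] HomD by metis
  have o: "b \<in> Obj C" "c \<in> Obj C" "d \<in> Obj C" using HomD[OF g] HomD[OF q] by auto
  have k0: "zero_arr C k" by (rule Tri_split_mono_zero[OF T g v vg])
  \<comment> \<open>\<open>q\<close> is epic: an arrow that kills \<open>q\<close> factors through
    \<open>k\<close>, which is zero.\<close>
  have epi: "zero_arr C t" if t: "t \<in> Hom C d e" "zero_arr C (t \<cdot> q)" for t e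
  proof -
    obtain v' where v': "v' \<in> Hom C (SO b) e" "t = v' \<cdot> k"
      using Tri_weak_cokernel[OF Tri_rot[OF T] q k t] .
    then show ?thesis using zero_arr_Comp[OF k v'(1)] k0 by simp
  qed
  \<comment> \<open>\<open>p\<close> is the idempotent onto \<open>b\<close> and \<open>n\<close>
    below is its complement 1 - \<open>p\<close>. As \<open>n\<close> kills \<open>g\<close>, it
    factors as \<open>s \<cdot> q\<close> through the cone, and \<open>s\<close> is the second
    inclusion.\<close>
  define p where "p = g \<cdot> v"
  have gv: "p \<in> Hom C c c" unfolding p_def using Comp_closed[OF v g] .
  define n where "n = Plus C (Id C c) (Neg C p)"
  have ne: "Neg C p \<in> Hom C c c" "Id C c \<in> Hom C c c" using Neg_Hom[OF gv] Id_closed[OF o(2)] by auto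
  have n: "n \<in> Hom C c c" unfolding n_def using Plus_Hom[OF ne(2,1)] .
  have np: "Plus C n p = Id C c" unfolding n_def
    using Plus_assoc[OF ne(2,1) gv] Neg_Hom(3)[OF gv] Plus_Zer[OF ne(2)] by simp
  have pg: "p \<cdot> g = g" unfolding p_def using Comp_assoc[OF g v g] vg Comp_Id[OF g] by simp
  have vp: "v \<cdot> p = v" unfolding p_def using Comp_assoc[OF v g v] vg Id_Comp[OF v] by simp
  have cancel: "x = Zer C a' b'"
    if "x \<in> Hom C a' b'" "y \<in> Hom C a' b'" "Plus C x y = y" for x y a' b'
  proof -
    have o': "a' \<in> Obj C" "b' \<in> Obj C" using HomD[OF that(1)] by auto
    have "Plus C (Plus C x y) (Neg C y) = Plus C x (Plus C y (Neg C y))"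
      using Plus_assoc[OF that(1,2) Neg_Hom(1)[OF that(2)]] .
    then show ?thesis using that(3) Neg_Hom(2)[OF that(2)] Plus_Zer[OF that(1)] by simp
  qed
  have "Plus C (n \<cdot> g) g = g"
    using Plus_Comp[OF g n gv] np pg Id_Comp[OF g] by simp
  then have ng: "zero_arr C (n \<cdot> g)"
    using cancel[OF Comp_closed[OF g n] g] zero_arr_Zer[OF o(1,2)] by simp
  have "Plus C (v \<cdot> n) v = v"
    using Comp_Plus[OF n gv v] np vp Comp_Id[OF v] by simp
  then have vn: "zero_arr C (v \<cdot> n)"
    using cancel[OF Comp_closed[OF n v] v] zero_arr_Zer[OF o(2,1)] by simp
  obtain s where s: "s \<in> Hom C d c" "n = s \<cdot> q" using Tri_weak_cokernel[OF T g q n ng] .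
  have "zero_arr C (v \<cdot> s)"
    using epi[OF Comp_closed[OF s(1) v]] Comp_assoc[OF q s(1) v] vn s(2) by simp
  then have vs: "v \<cdot> s = Zer C d b" using zero_arr_iff[OF Comp_closed[OF s(1) v]] by simp
  have qg: "q \<cdot> g = Zer C b d"
    using Tri_comp_zero[OF T] zero_arr_iff[OF Comp_closed[OF g q]] by simp
  have "q \<cdot> p = Zer C c d"
    unfolding p_def using Comp_assoc[OF v g q] qg Zer_Comp[OF v o(3)] by simp
  then have qn: "q \<cdot> n = q"
    using Comp_Plus[OF n gv q] np Comp_Id[OF q] Plus_Zer[OF Comp_closed[OF n q]] by simp
  \<comment> \<open>\<open>t\<close> is the defect 1 - \<open>q \<cdot> s\<close>. It kills
    \<open>q\<close>, because \<open>q \<cdot> s \<cdot> q = q \<cdot> n = q\<close>, and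
    \<open>q\<close> is epic; hence \<open>q \<cdot> s\<close> is the identity.\<close>
  define t where "t = Plus C (Neg C (q \<cdot> s)) (Id C d)"
  have qs: "q \<cdot> s \<in> Hom C d d" and Id_d: "Id C d \<in> Hom C d d" and nqs: "Neg C (q \<cdot> s) \<in> Hom C d d"
    using Comp_closed[OF s(1) q] Id_closed[OF o(3)] Neg_Hom by auto
  have t: "t \<in> Hom C d d" unfolding t_def using Plus_Hom[OF nqs Id_d] .
  have qst: "Plus C (q \<cdot> s) t = Id C d" unfolding t_def
    using Plus_assoc[OF qs nqs Id_d] Neg_Hom(2)[OF qs] Plus_Zer[OF Id_d] by simp
  have tqs: "Plus C t (q \<cdot> s) = Id C d"
  proof -
    interpret G: comm_group "hom_group C d d" using hom_group o by auto
    show ?thesis using G.m_comm[of t "q \<cdot> s"] t qs qst by (simp add: hom_group_def)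
  qed
  have qsq: "(q \<cdot> s) \<cdot> q = q" using Comp_assoc[OF q s(1) q] s(2) qn by simp
  have "Plus C (t \<cdot> q) q = q"
    using Plus_Comp[OF q t qs] tqs qsq Id_Comp[OF q] by simp
  then have "zero_arr C (t \<cdot> q)"
    using cancel[OF Comp_closed[OF q t] q] zero_arr_Zer[OF o(2,3)] by simp
  then have "t = Zer C d d" using epi[OF t] zero_arr_iff[OF t] by simp
  then have qs1: "q \<cdot> s = Id C d" using qst Plus_Zer[OF qs] by simp
  have sum: "Plus C (g \<cdot> v) (s \<cdot> q) = Id C c"
  proof -
    interpret G: comm_group "hom_group C c c" using hom_group o by auto
    show ?thesis using G.m_comm[of n p] n gv np s(2) by (simp add: hom_group_def p_def)
  qed
  have "biproduct C b d c"
    unfolding biproduct_def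
    by (intro conjI o bexI[OF _ g] bexI[OF _ s(1)] bexI[OF _ v] bexI[OF _ q] vg qs1 vs qg sum)
  then show ?thesis by (rule that)
qed

end

section \<open>Thick subcategories: retracts and two-out-of-three\<close>

lemma thick_iso: "thick_subcategory C J \<Longrightarrow> isomorphic C a b \<Longrightarrow> a \<in> J \<Longrightarrow> b \<in> Obj C \<Longrightarrow> b \<in> J"
  by (auto simp: thick_subcategory_def)

lemma thick_Obj: "thick_subcategory C J \<Longrightarrow> a \<in> J \<Longrightarrow> a \<in> Obj C"
  by (auto simp: thick_subcategory_def)

lemma thick_zero: "thick_subcategory C J \<Longrightarrow> zero_object C z \<Longrightarrow> z \<in> J"
  by (auto simp: thick_subcategory_def)

lemma thick_Shift: "thick_subcategory C J \<Longrightarrow> a \<in> Obj C \<Longrightarrow> omap (Shift C) a \<in> J \<longleftrightarrow> a \<in> J"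
  by (auto simp: thick_subcategory_def)

lemma thick_cone:
  "thick_subcategory C J \<Longrightarrow> (f, g, h) \<in> Tri C \<Longrightarrow> Dom C f \<in> J \<Longrightarrow> Cod C f \<in> J \<Longrightarrow> Cod C g \<in> J"
  unfolding thick_subcategory_def by blast

lemma thick_summand:
  "thick_subcategory C J \<Longrightarrow> biproduct C a b c \<Longrightarrow> c \<in> J \<Longrightarrow> a \<in> J \<and> b \<in> J"
  unfolding thick_subcategory_def by blast

context triangulated_category
begin

text \<open>The cone of \<open>g\<close> complements \<open>b\<close> in \<open>c\<close>. Being a
  retract is a single equation, so it passes through functors and tensor products more directly than
  a biproduct does.\<close>

lemma thick_retract:
  assumes "thick_subcategory C J" "g \<in> Hom C b c" "v \<in> Hom C c b" "v \<cdot> g = Id C b" "c \<in> J"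
  shows "b \<in> J"
proof -
  obtain d where "biproduct C b d c" using split_mono_biproduct[OF assms(2-4)] .
  then show ?thesis using thick_summand[OF assms(1)] assms(5) by blast
qed

text \<open>After one rotation the suspension of the source is a cone, and thick subcategories are
  closed under desuspension.\<close>

lemma thick_dom:
  assumes J: "thick_subcategory C J" and T: "(f, g, h) \<in> Tri C" and "Cod C f \<in> J" "Cod C g \<in> J"
  shows "Dom C f \<in> J"
proof -
  obtain a b c where H: "f \<in> Hom C a b" "g \<in> Hom C b c" "h \<in> Hom C c (SO a)" using TriE[OF T] .
  have "Cod C h \<in> J" using thick_cone[OF J Tri_rot[OF T]] assms HomD[OF H(1)] HomD[OF H(2)] by simp
  then show ?thesis using thick_Shift[OF J, of a] HomD[OF H(1)] HomD[OF H(3)] by simp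
qed

text \<open>After two rotations the suspension of the middle object is a cone.\<close>

lemma thick_middle:
  assumes J: "thick_subcategory C J" and T: "(f, g, h) \<in> Tri C" and "Dom C f \<in> J" "Cod C g \<in> J"
  shows "Cod C f \<in> J"
proof -
  obtain a b c where H: "f \<in> Hom C a b" "g \<in> Hom C b c" "h \<in> Hom C c (SO a)" using TriE[OF T] .
  have "SO a \<in> J" using assms(3) thick_Shift[OF J, of a] HomD[OF H(1)] by simp
  then have "Cod C (Neg C (SA f)) \<in> J"
    using thick_cone[OF J Tri_rot[OF Tri_rot[OF T]]] assms HomD[OF H(3)] HomD[OF H(2)] by simp
  then show ?thesis
    using thick_Shift[OF J, of b] HomD[OF Neg_Hom(1)[OF SA_closed[OF H(1)]]] HomD[OF H(1)] by simp
qed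

text \<open>When \<open>f\<close> vanishes, the identity of its target factors through
  \<open>g\<close>, so the target is a retract of the cone.\<close>

lemma thick_zero_arr:
  assumes J: "thick_subcategory C J" and T: "(f, g, h) \<in> Tri C" and z: "zero_arr C f" and "Cod C g \<in> J"
  shows "Cod C f \<in> J"
proof -
  obtain a b c where H: "f \<in> Hom C a b" "g \<in> Hom C b c" "h \<in> Hom C c (SO a)" using TriE[OF T] .
  have b: "Id C b \<in> Hom C b b" using Id_closed HomD[OF H(1)] by simp
  have "zero_arr C (Id C b \<cdot> f)" using Id_Comp[OF H(1)] z by simp
  then obtain v where v: "v \<in> Hom C c b" "Id C b = v \<cdot> g" using Tri_weak_cokernel[OF T H(1,2) b] by blast
  have "b \<in> J" using thick_retract[OF J H(2) v(1) v(2)[symmetric]] assms(4) HomD[OF H(2)] by simp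
  then show ?thesis using HomD[OF H(1)] by simp
qed

end

text \<open>For thick \<open>J\<close> these are the arrows that become invertible in the Verdier
  quotient by \<open>J\<close>.\<close>

definition cone_in :: "('o, 'm, 'x) tri_cat_scheme \<Rightarrow> 'o set \<Rightarrow> 'm \<Rightarrow> bool" where
  "cone_in C J f \<longleftrightarrow> (\<exists>g h. (f, g, h) \<in> Tri C \<and> Cod C g \<in> J)"

context triangulated_category
begin

lemma cone_in_Id:
  assumes "thick_subcategory C J" "a \<in> Obj C"
  shows "cone_in C J (Id C a)"
proof -
  obtain z where z: "zero_object C z" using ex_zero_object by blast
  have o: "z \<in> Obj C" using z by (simp add: zero_object_def)
  show ?thesis
    using Tri_Id[OF assms(2) z] thick_zero[OF assms(1) z] HomD[OF Zer_Hom[OF assms(2) o]]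
    unfolding cone_in_def by metis
qed

text \<open>The octahedral axiom places the cone of the composite in the middle of a triangle whose
  outer objects are the cones of \<open>f\<close> and \<open>g\<close>.\<close>

lemma cone_in_Comp:
  assumes J: "thick_subcategory C J" and "f \<in> Hom C a b" "g \<in> Hom C b c"
    and "cone_in C J f" "cone_in C J g"
  shows "cone_in C J (g \<cdot> f)"
proof -
  obtain f' f'' where f: "(f, f', f'') \<in> Tri C" "Cod C f' \<in> J" using assms by (auto simp: cone_in_def)
  obtain g' g'' where g: "(g, g', g'') \<in> Tri C" "Cod C g' \<in> J" using assms by (auto simp: cone_in_def)
  obtain k' k'' where k: "(g \<cdot> f, k', k'') \<in> Tri C"
    using Tri_cone HomD[OF Comp_closed[OF assms(2,3)]] by blast
  have "Dom C g = Cod C f" using HomD[OF assms(2)] HomD[OF assms(3)] by simp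
  then obtain u v where uv: "u \<in> Hom C (Cod C f') (Cod C k')" "v \<in> Hom C (Cod C k') (Cod C g')"
    "(u, v, SA f' \<cdot> g'') \<in> Tri C"
    using Tri_octahedron[OF f(1) g(1) _ k] by blast
  have "Cod C k' \<in> J"
    using thick_middle[OF J uv(3)] HomD[OF uv(1)] HomD[OF uv(2)] f(2) g(2) by simp
  then show ?thesis using k by (auto simp: cone_in_def)
qed

end


section \<open>Tensor products and tensor powers\<close>

context symmetric_monoidal_category
begin

lemma tensor_is_iso:
  assumes "u \<in> Hom C a a'" "v \<in> Hom C b b'" "is_iso C u" "is_iso C v"
  shows "is_iso C (u \<otimes>\<^sub>a v)"
proof -
  obtain u' where u': "u' \<in> Hom C a' a" "u' \<cdot> u = Id C a" "u \<cdot> u' = Id C a'"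
    by (rule is_isoE[OF assms(3,1)])
  obtain v' where v': "v' \<in> Hom C b' b" "v' \<cdot> v = Id C b" "v \<cdot> v' = Id C b'"
    by (rule is_isoE[OF assms(4,2)])
  have o: "a \<in> Obj C" "a' \<in> Obj C" "b \<in> Obj C" "b' \<in> Obj C"
    using HomD[OF assms(1)] HomD[OF assms(2)] by auto
  show ?thesis
    by (rule is_isoI[OF TArr_closed[OF assms(1,2)] TArr_closed[OF u'(1) v'(1)]])
      (simp_all add: TArr_Comp[OF assms(1) u'(1) assms(2) v'(1), symmetric] u' v' TArr_Id o
        TArr_Comp[OF u'(1) assms(1) v'(1) assms(2), symmetric])
qed

lemma arr_iso_tensor:
  assumes "arr_iso C f f'" "arr_iso C g g'"
  shows "arr_iso C (f \<otimes>\<^sub>a g) (f' \<otimes>\<^sub>a g')"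
proof -
  obtain u v a b a' b' where 1: "f \<in> Hom C a b" "f' \<in> Hom C a' b'" "u \<in> Hom C a a'"
    "v \<in> Hom C b b'" "is_iso C u" "is_iso C v" "v \<cdot> f = f' \<cdot> u"
    by (rule arr_isoE[OF assms(1)])
  obtain s t c d c' d' where 2: "g \<in> Hom C c d" "g' \<in> Hom C c' d'" "s \<in> Hom C c c'"
    "t \<in> Hom C d d'" "is_iso C s" "is_iso C t" "t \<cdot> g = g' \<cdot> s"
    by (rule arr_isoE[OF assms(2)])
  have "(v \<otimes>\<^sub>a t) \<cdot> (f \<otimes>\<^sub>a g) = (f' \<otimes>\<^sub>a g') \<cdot> (u \<otimes>\<^sub>a s)"
    using TArr_Comp[OF 1(1,4) 2(1,4)] TArr_Comp[OF 1(3,2) 2(3,2)] 1(7) 2(7) by simp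
  then show ?thesis
    by (rule arr_isoI[OF TArr_closed[OF 1(1) 2(1)] TArr_closed[OF 1(2) 2(2)]
      TArr_closed[OF 1(3) 2(3)] TArr_closed[OF 1(4) 2(4)]
      tensor_is_iso[OF 1(3) 2(3) 1(5) 2(5)] tensor_is_iso[OF 1(4) 2(4) 1(6) 2(6)]])
qed

lemma TArr_Arr: "f \<in> Arr C \<Longrightarrow> g \<in> Arr C \<Longrightarrow> f \<otimes>\<^sub>a g \<in> Arr C"
  using TArr_closed[OF Hom_Arr Hom_Arr] HomD by blast

lemma Id_Arr: "a \<in> Obj C \<Longrightarrow> Id C a \<in> Arr C"
  using Id_closed HomD by blast

lemma arr_iso_assoc:
  assumes "f \<in> Arr C" "g \<in> Arr C" "h \<in> Arr C"
  shows "arr_iso C ((f \<otimes>\<^sub>a g) \<otimes>\<^sub>a h) (f \<otimes>\<^sub>a (g \<otimes>\<^sub>a h))"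
proof -
  note H = assms[THEN Hom_Arr]
  note d = assms[THEN Dom_closed] and c = assms[THEN Cod_closed]
  show ?thesis
    using assoc_closed[OF d] assoc_closed[OF c] assoc_natural[OF H]
      arr_isoI[OF TArr_closed[OF TArr_closed[OF H(1,2)] H(3)] TArr_closed[OF H(1) TArr_closed[OF H(2,3)]]]
    by blast
qed

lemma braid_iso: "a \<in> Obj C \<Longrightarrow> b \<in> Obj C \<Longrightarrow> is_iso C (braid C a b)"
  using is_isoI[OF braid_closed braid_closed] braid_braid by blast

lemma arr_iso_braid:
  assumes "f \<in> Arr C" "g \<in> Arr C"
  shows "arr_iso C (f \<otimes>\<^sub>a g) (g \<otimes>\<^sub>a f)"
proof -
  note H = assms[THEN Hom_Arr]
  note d = assms[THEN Dom_closed] and c = assms[THEN Cod_closed]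
  show ?thesis
    by (rule arr_isoI[OF TArr_closed[OF H] TArr_closed[OF H(2,1)] braid_closed[OF d] braid_closed[OF c]
      braid_iso[OF d] braid_iso[OF c] braid_natural[OF H]])
qed

lemma arr_iso_lunit:
  assumes "f \<in> Arr C"
  shows "arr_iso C (Id C (Unit C) \<otimes>\<^sub>a f) f"
proof -
  note H = assms[THEN Hom_Arr]
  note d = assms[THEN Dom_closed] and c = assms[THEN Cod_closed]
  show ?thesis
    using arr_isoI[OF TArr_closed[OF Id_closed[OF Unit_closed] H] H] lunit_closed[OF d]
      lunit_closed[OF c] lunit_natural[OF H] by blast
qed

lemma iso_tensor:
  assumes "isomorphic C a a'" "isomorphic C b b'"
  shows "isomorphic C (a \<otimes>\<^sub>o b) (a' \<otimes>\<^sub>o b')"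
  using assms tensor_is_iso TArr_closed unfolding isomorphic_def by blast

lemma iso_assoc:
  "a \<in> Obj C \<Longrightarrow> b \<in> Obj C \<Longrightarrow> c \<in> Obj C \<Longrightarrow> isomorphic C ((a \<otimes>\<^sub>o b) \<otimes>\<^sub>o c) (a \<otimes>\<^sub>o (b \<otimes>\<^sub>o c))"
  using assoc_closed isoI by blast

lemma iso_braid: "a \<in> Obj C \<Longrightarrow> b \<in> Obj C \<Longrightarrow> isomorphic C (a \<otimes>\<^sub>o b) (b \<otimes>\<^sub>o a)"
  using braid_closed braid_iso isoI by blast

lemma iso_lunit: "a \<in> Obj C \<Longrightarrow> isomorphic C (Unit C \<otimes>\<^sub>o a) a"
  using lunit_closed isoI by blast

section \<open>Tensor powers\<close>

lemma tpow_obj_closed: "a \<in> Obj C \<Longrightarrow> tpow_obj C a n \<in> Obj C"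
  by (induction n) (auto simp: Unit_closed TObj_closed)

lemma tpow_closed:
  "f \<in> Hom C a b \<Longrightarrow> tpow C f n \<in> Hom C (tpow_obj C a n) (tpow_obj C b n)"
  by (induction n) (auto simp: Unit_closed Id_closed TArr_closed)

lemma tpow_Arr: "f \<in> Arr C \<Longrightarrow> tpow C f n \<in> Arr C"
  using tpow_closed[OF Hom_Arr] HomD by blast

lemma tpow_Id: "a \<in> Obj C \<Longrightarrow> tpow C (Id C a) n = Id C (tpow_obj C a n)"
  by (induction n) (auto simp: TArr_Id tpow_obj_closed)

text \<open>Powers are bracketed to the right and end in the unit: the base case is a left unitor
  and every further factor costs one associator.\<close>

lemma tpow_add:
  assumes "f \<in> Arr C"
  shows "arr_iso C (tpow C f m \<otimes>\<^sub>a tpow C f n) (tpow C f (m + n))"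
proof (induction m)
  case 0
  show ?case using arr_iso_lunit[OF tpow_Arr[OF assms]] by simp
next
  case (Suc m)
  have "arr_iso C ((f \<otimes>\<^sub>a tpow C f m) \<otimes>\<^sub>a tpow C f n) (f \<otimes>\<^sub>a (tpow C f m \<otimes>\<^sub>a tpow C f n))"
    using arr_iso_assoc assms tpow_Arr by blast
  also have "arr_iso C \<dots> (f \<otimes>\<^sub>a tpow C f (m + n))"
    using arr_iso_tensor[OF arr_iso_refl[OF assms] Suc] .
  finally show ?case by simp
qed

lemma tpow_obj_add:
  assumes "a \<in> Obj C"
  shows "isomorphic C (tpow_obj C a m \<otimes>\<^sub>o tpow_obj C a n) (tpow_obj C a (m + n))"
  using tpow_add[OF Id_Arr[OF assms], of m n] assms
  by (simp add: tpow_Id TArr_Id tpow_obj_closed TObj_closed arr_iso_Id_iff)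

text \<open>The two ways around the bifunctoriality square. They let the vanishing of
  \<open>f\<close> or \<open>g\<close> tensored with an identity pass to
  \<open>f \<otimes>\<^sub>a g\<close>.\<close>

lemma tensor_interchange:
  assumes "f \<in> Hom C a b" "g \<in> Hom C c d"
  shows "f \<otimes>\<^sub>a g = (f \<otimes>\<^sub>a Id C d) \<cdot> (Id C a \<otimes>\<^sub>a g)"
    and "f \<otimes>\<^sub>a g = (Id C b \<otimes>\<^sub>a g) \<cdot> (f \<otimes>\<^sub>a Id C c)"
proof -
  have i: "Id C a \<in> Hom C a a" "Id C b \<in> Hom C b b" "Id C c \<in> Hom C c c" "Id C d \<in> Hom C d d"
    using Id_closed HomD[OF assms(1)] HomD[OF assms(2)] by auto
  show "f \<otimes>\<^sub>a g = (f \<otimes>\<^sub>a Id C d) \<cdot> (Id C a \<otimes>\<^sub>a g)"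
    using TArr_Comp[OF i(1) assms i(4)] Comp_Id[OF assms(1)] Id_Comp[OF assms(2)] by simp
  show "f \<otimes>\<^sub>a g = (Id C b \<otimes>\<^sub>a g) \<cdot> (f \<otimes>\<^sub>a Id C c)"
    using TArr_Comp[OF assms(1) i(2,3) assms(2)] Comp_Id[OF assms(2)] Id_Comp[OF assms(1)] by simp
qed

end


section \<open>Tensor ideals\<close>

context tt_category
begin

section \<open>Exactness of the tensor product and shifts\<close>

lemma tensor_left_additive: "a \<in> Obj C \<Longrightarrow> additive_functor C C (tensor_left C a)"
  using tensor_left_exact by (simp add: exact_functor_def)

lemma zero_arr_Id_tensor:
  assumes "a \<in> Obj C" "zero_arr C f" shows "zero_arr C (Id C a \<otimes>\<^sub>a f)"
  using additive_functor_zero[OF additive additive tensor_left_additive[OF assms(1)] assms(2)]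
  by (simp add: tensor_left_def)

text \<open>If \<open>g\<close> is zero, the product factors through an identity tensored with
  \<open>g\<close>; the braiding reduces the other case to this one.\<close>

lemma zero_arr_tensor:
  assumes "f \<in> Arr C" "g \<in> Arr C" "zero_arr C f \<or> zero_arr C g"
  shows "zero_arr C (f \<otimes>\<^sub>a g)"
proof -
  have *: "zero_arr C (f \<otimes>\<^sub>a g)" if H: "f \<in> Arr C" "zero_arr C g" for f g
  proof -
    have g: "g \<in> Arr C" using H by (simp add: zero_arr_def)
    have i: "Id C (Dom C f) \<in> Hom C (Dom C f) (Dom C f)" "Id C (Cod C g) \<in> Hom C (Cod C g) (Cod C g)"
      using Id_closed Dom_closed Cod_closed H g by auto
    show ?thesis
      using zero_arr_Comp[OF TArr_closed[OF i(1) Hom_Arr[OF g]] TArr_closed[OF Hom_Arr[OF H(1)] i(2)]]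
        zero_arr_Id_tensor[OF Dom_closed[OF H(1)] H(2)]
        tensor_interchange(1)[OF Hom_Arr[OF H(1)] Hom_Arr[OF g]] by simp
  qed
  show ?thesis using assms * arr_iso_zero[OF arr_iso_braid[OF assms(1,2)]] by blast
qed

lemma Tri_tensor_left:
  assumes "x \<in> Obj C" "(f, g, h) \<in> Tri C"
  obtains \<phi> where "(Id C x \<otimes>\<^sub>a f, Id C x \<otimes>\<^sub>a g, \<phi> \<cdot> (Id C x \<otimes>\<^sub>a h)) \<in> Tri C"
    "\<phi> \<in> Hom C (x \<otimes>\<^sub>o SO (Dom C f)) (SO (x \<otimes>\<^sub>o Dom C f))" "is_iso C \<phi>"
proof -
  have f: "Dom C f \<in> Obj C" using Tri_triangle[OF assms(2)] Dom_closed by (simp add: triangle_def)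
  obtain \<phi> where "natural_iso C C (comp_func (tensor_left C x) (Shift C)) (comp_func (Shift C) (tensor_left C x)) \<phi>"
    "\<forall>f g h. (f, g, h) \<in> Tri C \<longrightarrow> (amap (tensor_left C x) f, amap (tensor_left C x) g, \<phi> (Dom C f) \<cdot> amap (tensor_left C x) h) \<in> Tri C"
    using tensor_left_exact[OF assms(1)] by (auto simp: exact_functor_def)
  then show ?thesis using that[of "\<phi> (Dom C f)"] f assms(2)
    by (simp add: tensor_left_def comp_func_def natural_iso_def)
qed

lemma Tri_tensor_right:
  assumes "x \<in> Obj C" "(f, g, h) \<in> Tri C"
  obtains \<phi> where "(f \<otimes>\<^sub>a Id C x, g \<otimes>\<^sub>a Id C x, \<phi> \<cdot> (h \<otimes>\<^sub>a Id C x)) \<in> Tri C"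
    "\<phi> \<in> Hom C (SO (Dom C f) \<otimes>\<^sub>o x) (SO (Dom C f \<otimes>\<^sub>o x))" "is_iso C \<phi>"
proof -
  have f: "Dom C f \<in> Obj C" using Tri_triangle[OF assms(2)] Dom_closed by (simp add: triangle_def)
  obtain \<phi> where "natural_iso C C (comp_func (tensor_right C x) (Shift C)) (comp_func (Shift C) (tensor_right C x)) \<phi>"
    "\<forall>f g h. (f, g, h) \<in> Tri C \<longrightarrow> (amap (tensor_right C x) f, amap (tensor_right C x) g, \<phi> (Dom C f) \<cdot> amap (tensor_right C x) h) \<in> Tri C"
    using tensor_right_exact[OF assms(1)] by (auto simp: exact_functor_def)
  then show ?thesis using that[of "\<phi> (Dom C f)"] f assms(2)
    by (simp add: tensor_right_def comp_func_def natural_iso_def)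
qed

text \<open>The isomorphism is part of the exactness of tensoring with \<open>a\<close>; the
  identity triangle on \<open>x\<close> serves to evaluate it at \<open>x\<close>.\<close>

lemma iso_Shift_tensor:
  assumes "x \<in> Obj C" "a \<in> Obj C"
  shows "isomorphic C (SO x \<otimes>\<^sub>o a) (SO (x \<otimes>\<^sub>o a))"
proof -
  obtain z where z: "zero_object C z" using ex_zero_object by blast
  show ?thesis
    using Tri_tensor_right[OF assms(2) Tri_Id[OF assms(1) z]] isoI HomD[OF Id_closed[OF assms(1)]] by metis
qed

lemma iso_Shift_Unit_tensor:
  assumes "a \<in> Obj C" shows "isomorphic C (SO (Unit C) \<otimes>\<^sub>o a) (SO a)"
  using iso_trans[OF iso_Shift_tensor[OF Unit_closed assms]]
    functor_isomorphic[OF _ _ Shift_functor iso_lunit[OF assms]] category_axioms by blast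

lemma ex_desuspension:
  assumes "a \<in> Obj C" obtains t where "t \<in> Obj C" "isomorphic C (SO t) a"
proof -
  obtain G :: "('o, 'm, 'o, 'm) func" and \<epsilon> where "is_functor C C G"
    "natural_iso C C (comp_func (Shift C) G) id_func \<epsilon>"
    using Shift_equivalence by (auto simp: is_equivalence_def)
  then have "omap G a \<in> Obj C" "isomorphic C (SO (omap G a)) a"
    using assms isoI functor_Obj by (auto simp: natural_iso_def comp_func_def id_func_def)
  then show ?thesis by (rule that)
qed

text \<open>Closure under \<open>\<otimes>\<close> takes care of shifts, because \<open>\<Sigma>a \<cong> \<Sigma>1 \<otimes> a\<close>.\<close>

lemma tt_idealI:
  assumes sub: "J \<subseteq> Obj C"
    and zero: "\<And>z. zero_object C z \<Longrightarrow> z \<in> J"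
    and iso: "\<And>a b. a \<in> J \<Longrightarrow> b \<in> Obj C \<Longrightarrow> isomorphic C a b \<Longrightarrow> b \<in> J"
    and tensor: "\<And>a b. a \<in> J \<Longrightarrow> b \<in> Obj C \<Longrightarrow> b \<otimes>\<^sub>o a \<in> J"
    and cone: "\<And>f g h. (f, g, h) \<in> Tri C \<Longrightarrow> Dom C f \<in> J \<Longrightarrow> Cod C f \<in> J \<Longrightarrow> Cod C g \<in> J"
    and retract: "\<And>b c g v. g \<in> Hom C b c \<Longrightarrow> v \<in> Hom C c b \<Longrightarrow> v \<cdot> g = Id C b \<Longrightarrow> c \<in> J \<Longrightarrow> b \<in> J"
  shows "tt_ideal C J"
proof -
  have Sa: "SO a \<in> J" if "a \<in> J" for a
    using iso[OF tensor[OF that SO_closed[OF Unit_closed]]] iso_Shift_Unit_tensor[of a] that sub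
      SO_closed by blast
  have "a \<in> J" if a: "a \<in> Obj C" "SO a \<in> J" for a
  proof -
    \<comment> \<open>\<open>t\<close> is a desuspension of the unit. Tensoring with it undoes
      \<open>SO\<close>, because the shift can be moved from \<open>a\<close> to
      \<open>t\<close>.\<close>
    obtain t where t: "t \<in> Obj C" "isomorphic C (SO t) (Unit C)" using ex_desuspension[OF Unit_closed] .
    have ta: "isomorphic C (t \<otimes>\<^sub>o SO a) a"
    proof -
      have "isomorphic C (t \<otimes>\<^sub>o SO a) (SO a \<otimes>\<^sub>o t)" using iso_braid t a SO_closed by blast
      also have "isomorphic C (SO a \<otimes>\<^sub>o t) (SO (a \<otimes>\<^sub>o t))" using iso_Shift_tensor t a by blast
      also have "isomorphic C (SO (a \<otimes>\<^sub>o t)) (SO (t \<otimes>\<^sub>o a))"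
        using functor_isomorphic[OF _ _ Shift_functor iso_braid] t a category_axioms by blast
      also have "isomorphic C (SO (t \<otimes>\<^sub>o a)) (SO t \<otimes>\<^sub>o a)" using iso_sym[OF iso_Shift_tensor] t a by blast
      also have "isomorphic C (SO t \<otimes>\<^sub>o a) (Unit C \<otimes>\<^sub>o a)" using iso_tensor[OF t(2) iso_refl] a by blast
      also have "isomorphic C (Unit C \<otimes>\<^sub>o a) a" using iso_lunit a by blast
      finally show ?thesis .
    qed
    show ?thesis using iso[OF tensor[OF a(2) t(1)] a(1) ta] .
  qed
  then have shift: "\<forall>a \<in> Obj C. SO a \<in> J \<longleftrightarrow> a \<in> J" using Sa by blast
  have summand: "a \<in> J \<and> b \<in> J" if "biproduct C a b c" "c \<in> J" for a b c
    using that retract unfolding biproduct_def by blast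
  have "thick_subcategory C J"
    unfolding thick_subcategory_def using sub zero iso cone shift summand by blast
  moreover have "a \<otimes>\<^sub>o b \<in> J" if "a \<in> J" "b \<in> Obj C" for a b
    using iso[OF tensor[OF that] _ iso_braid] that sub TObj_closed by blast
  ultimately show ?thesis unfolding tt_ideal_def using tensor by blast
qed

text \<open>The ideal quotient \<open>P : b\<close>, inherited from \<open>P\<close> because
  tensoring with \<open>b\<close> is exact and preserves retracts. It supplies the larger ideal in
  the maximality argument of \<open>prime_avoidance\<close>.\<close>

lemma colon_ideal:
  assumes P: "tt_ideal C P" and b: "b \<in> Obj C"
  shows "tt_ideal C {c \<in> Obj C. c \<otimes>\<^sub>o b \<in> P}" (is "tt_ideal C ?J")
proof (rule tt_idealI)
  have th: "thick_subcategory C P" using P by (simp add: tt_ideal_def)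
  note iso = thick_iso[OF th]
  show "?J \<subseteq> Obj C" by auto
  show "z \<in> ?J" if "zero_object C z" for z
    using thick_zero[OF th that] that P b by (auto simp: tt_ideal_def zero_object_def)
  show "c \<in> ?J" if "a \<in> ?J" "c \<in> Obj C" "isomorphic C a c" for a c
    using that iso[OF iso_tensor[OF that(3) iso_refl[OF b]]] TObj_closed b by blast
  show "c \<otimes>\<^sub>o a \<in> ?J" if "a \<in> ?J" "c \<in> Obj C" for a c
  proof -
    have "c \<otimes>\<^sub>o (a \<otimes>\<^sub>o b) \<in> P" using that P by (auto simp: tt_ideal_def)
    moreover have ca: "c \<otimes>\<^sub>o a \<in> Obj C" "(c \<otimes>\<^sub>o a) \<otimes>\<^sub>o b \<in> Obj C"
      using that b TObj_closed by simp_all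
    moreover have "isomorphic C (c \<otimes>\<^sub>o (a \<otimes>\<^sub>o b)) ((c \<otimes>\<^sub>o a) \<otimes>\<^sub>o b)"
      using iso_sym[OF iso_assoc] that b by simp
    ultimately show ?thesis using iso by simp
  qed
  show "Cod C g \<in> ?J" if T: "(f, g, h) \<in> Tri C" and J: "Dom C f \<in> ?J" "Cod C f \<in> ?J" for f g h
  proof -
    obtain a c d where H: "f \<in> Hom C a c" "g \<in> Hom C c d" using TriE[OF T] by blast
    obtain \<phi> where T': "(f \<otimes>\<^sub>a Id C b, g \<otimes>\<^sub>a Id C b, \<phi> \<cdot> (h \<otimes>\<^sub>a Id C b)) \<in> Tri C"
      using Tri_tensor_right[OF b T] by blast
    show ?thesis
      using thick_cone[OF th T'] J HomD[OF H(1)] HomD[OF H(2)] HomD[OF TArr_closed[OF H(1) Id_closed[OF b]]]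
        HomD[OF TArr_closed[OF H(2) Id_closed[OF b]]] by simp
  qed
  show "a \<in> ?J" if H: "g \<in> Hom C a c" "v \<in> Hom C c a" "v \<cdot> g = Id C a" "c \<in> ?J" for a c g v
  proof -
    have i: "Id C b \<in> Hom C b b" using Id_closed[OF b] .
    have "(v \<otimes>\<^sub>a Id C b) \<cdot> (g \<otimes>\<^sub>a Id C b) = Id C (a \<otimes>\<^sub>o b)"
      using TArr_Comp[OF H(1,2) i i] H(3) Comp_Id[OF i] TArr_Id b HomD[OF H(1)] by simp
    then show ?thesis
      using thick_retract[OF th TArr_closed[OF H(1) i] TArr_closed[OF H(2) i]] H(4) HomD[OF H(1)] by simp
  qed
qed

text \<open>The delicate point is closure under cones: if the \<open>m\<close>-th power of
  \<open>g\<close> kills \<open>a\<close> and the \<open>n\<close>-th kills \<open>b\<close>, the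
  power \<open>m + n\<close> kills the cone of any arrow \<open>a \<rightarrow> b\<close>.\<close>

lemma annihilator_ideal:
  assumes g: "g \<in> Hom C x y"
  shows "tt_ideal C {a \<in> Obj C. \<exists>n. zero_arr C (tpow C g n \<otimes>\<^sub>a Id C a)}" (is "tt_ideal C ?J")
proof (rule tt_idealI)
  note G = tpow_closed[OF g]
  have ga: "g \<in> Arr C" using HomD[OF g] by simp
  note Ga = tpow_Arr[OF ga]
  have xy: "tpow_obj C x n \<in> Obj C" "tpow_obj C y n \<in> Obj C" for n
    using tpow_obj_closed HomD[OF g] by auto
  show "?J \<subseteq> Obj C" by auto
  show "z \<in> ?J" if "zero_object C z" for z
    using that zero_arr_tensor[OF Ga Id_Arr] by (auto simp: zero_object_iff)
  show "c \<in> ?J" if "a \<in> ?J" "c \<in> Obj C" "isomorphic C a c" for a c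
  proof -
    have "arr_iso C (Id C c) (Id C a)" using arr_iso_Id_iff iso_sym that by blast
    then have "arr_iso C (tpow C g n \<otimes>\<^sub>a Id C c) (tpow C g n \<otimes>\<^sub>a Id C a)" for n
      using arr_iso_tensor[OF arr_iso_refl[OF Ga]] by blast
    then show ?thesis using arr_iso_zero that by blast
  qed
  show "c \<otimes>\<^sub>o a \<in> ?J" if H: "a \<in> ?J" "c \<in> Obj C" for a c
  proof -
    obtain n where n: "zero_arr C (tpow C g n \<otimes>\<^sub>a Id C a)" using H(1) by blast
    have i: "Id C a \<in> Arr C" "Id C c \<in> Arr C" using Id_Arr H by auto
    have "zero_arr C ((tpow C g n \<otimes>\<^sub>a Id C a) \<otimes>\<^sub>a Id C c)"
      using zero_arr_tensor[OF TArr_Arr[OF Ga i(1)] i(2)] n by blast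
    moreover have "arr_iso C (tpow C g n \<otimes>\<^sub>a (Id C c \<otimes>\<^sub>a Id C a)) (tpow C g n \<otimes>\<^sub>a (Id C a \<otimes>\<^sub>a Id C c))"
      using arr_iso_tensor[OF arr_iso_refl[OF Ga] arr_iso_braid[OF i(2,1)]] .
    moreover have "arr_iso C (tpow C g n \<otimes>\<^sub>a (Id C a \<otimes>\<^sub>a Id C c)) ((tpow C g n \<otimes>\<^sub>a Id C a) \<otimes>\<^sub>a Id C c)"
      using arr_iso_sym[OF arr_iso_assoc[OF Ga i]] .
    ultimately have "zero_arr C (tpow C g n \<otimes>\<^sub>a (Id C c \<otimes>\<^sub>a Id C a))" using arr_iso_zero by blast
    then show ?thesis using H TObj_closed TArr_Id by auto
  qed
  show "a \<in> ?J" if H: "s \<in> Hom C a c" "v \<in> Hom C c a" "v \<cdot> s = Id C a" "c \<in> ?J" for a c s v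
  proof -
    obtain n where n: "zero_arr C (tpow C g n \<otimes>\<^sub>a Id C c)" using H(4) by blast
    have a: "a \<in> Obj C" using HomD[OF H(1)] by simp
    \<comment> \<open>This product passes through the vanishing
      \<open>tpow C g n \<otimes>\<^sub>a Id C c\<close>. Composing with \<open>v\<close> then turns
      \<open>s\<close> into the identity of \<open>a\<close>.\<close>
    have "zero_arr C (tpow C g n \<otimes>\<^sub>a s)"
      unfolding tensor_interchange(1)[OF G H(1)]
      using zero_arr_Comp[OF TArr_closed[OF Id_closed[OF xy(1)] H(1)] TArr_closed[OF G Id_closed]] n
        HomD[OF H(1)] by blast
    then have "zero_arr C ((Id C (tpow_obj C y n) \<otimes>\<^sub>a v) \<cdot> (tpow C g n \<otimes>\<^sub>a s))"
      using zero_arr_Comp[OF TArr_closed[OF G H(1)] TArr_closed[OF Id_closed[OF xy(2)] H(2)]] by blast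
    then have "zero_arr C (tpow C g n \<otimes>\<^sub>a Id C a)"
      using TArr_Comp[OF G Id_closed[OF xy(2)] H(1,2)] H(3) Id_Comp[OF G] by simp
    then show ?thesis using a by blast
  qed
  show "Cod C t \<in> ?J" if T: "(s, t, r) \<in> Tri C" and J: "Dom C s \<in> ?J" "Cod C s \<in> ?J" for s t r
  proof -
    obtain a b c where H: "s \<in> Hom C a b" "t \<in> Hom C b c" "r \<in> Hom C c (SO a)" using TriE[OF T] .
    have o: "a \<in> Obj C" "b \<in> Obj C" "c \<in> Obj C" "SO a \<in> Obj C"
      using HomD[OF H(1)] HomD[OF H(2)] SO_closed by auto
    obtain m where m: "zero_arr C (tpow C g m \<otimes>\<^sub>a Id C a)" using J(1) HomD[OF H(1)] by auto
    obtain n where n: "zero_arr C (tpow C g n \<otimes>\<^sub>a Id C b)" using J(2) HomD[OF H(1)] by auto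
    let ?X = "tpow_obj C x n" and ?Y = "tpow_obj C y n"
    obtain \<phi> where T': "(Id C ?X \<otimes>\<^sub>a s, Id C ?X \<otimes>\<^sub>a t, \<phi> \<cdot> (Id C ?X \<otimes>\<^sub>a r)) \<in> Tri C"
      and \<phi>: "\<phi> \<in> Hom C (?X \<otimes>\<^sub>o SO a) (SO (?X \<otimes>\<^sub>o a))" "is_iso C \<phi>"
      using Tri_tensor_left[OF xy(1) T] HomD[OF H(1)] by metis
    have XH: "Id C ?X \<otimes>\<^sub>a t \<in> Hom C (?X \<otimes>\<^sub>o b) (?X \<otimes>\<^sub>o c)"
      "\<phi> \<cdot> (Id C ?X \<otimes>\<^sub>a r) \<in> Hom C (?X \<otimes>\<^sub>o c) (SO (?X \<otimes>\<^sub>o a))"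
      "Id C ?X \<otimes>\<^sub>a r \<in> Hom C (?X \<otimes>\<^sub>o c) (?X \<otimes>\<^sub>o SO a)"
      using Comp_closed[OF TArr_closed[OF Id_closed[OF xy(1)] H(3)] \<phi>(1)]
        TArr_closed[OF Id_closed[OF xy(1)]] H by auto
    have Gc: "tpow C g n \<otimes>\<^sub>a Id C c \<in> Hom C (?X \<otimes>\<^sub>o c) (?Y \<otimes>\<^sub>o c)"
      using TArr_closed[OF G Id_closed[OF o(3)]] .
    \<comment> \<open>By interchange this composite first applies the power of \<open>g\<close> on
      \<open>b\<close>, where it is zero. The power on \<open>c\<close> therefore factors through
      \<open>r\<close> tensored with \<open>?X\<close>.\<close>
    have "zero_arr C ((tpow C g n \<otimes>\<^sub>a Id C c) \<cdot> (Id C ?X \<otimes>\<^sub>a t))"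
      unfolding tensor_interchange(1)[OF G H(2), symmetric] tensor_interchange(2)[OF G H(2)]
      using zero_arr_Comp[OF TArr_closed[OF G Id_closed[OF o(2)]] TArr_closed[OF Id_closed[OF xy(2)] H(2)]]
        n by blast
    then obtain v where v: "v \<in> Hom C (SO (?X \<otimes>\<^sub>o a)) (?Y \<otimes>\<^sub>o c)"
      "tpow C g n \<otimes>\<^sub>a Id C c = v \<cdot> (\<phi> \<cdot> (Id C ?X \<otimes>\<^sub>a r))"
      using Tri_weak_cokernel[OF Tri_rot[OF T'] XH(1,2) Gc] by blast
    have v\<phi>: "v \<cdot> \<phi> \<in> Hom C (?X \<otimes>\<^sub>o SO a) (?Y \<otimes>\<^sub>o c)" using Comp_closed[OF \<phi>(1) v(1)] .
    have factor: "tpow C g n \<otimes>\<^sub>a Id C c = (v \<cdot> \<phi>) \<cdot> (Id C ?X \<otimes>\<^sub>a r)"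
      using v(2) Comp_assoc[OF XH(3) \<phi>(1) v(1)] by simp
    have ia: "Id C a \<in> Arr C" "Id C ?X \<in> Arr C" "Id C (SO (Unit C)) \<in> Arr C"
      "Id C c \<in> Arr C" "Id C (SO a) \<in> Arr C"
      using Id_Arr o xy SO_closed[OF Unit_closed] by auto
    \<comment> \<open>Up to isomorphism the object is \<open>a\<close> tensored with something, and
      the \<open>m\<close>-th power kills \<open>a\<close>.\<close>
    have mS: "zero_arr C (tpow C g m \<otimes>\<^sub>a Id C (?X \<otimes>\<^sub>o SO a))"
    proof -
      have "isomorphic C (?X \<otimes>\<^sub>o SO a) (?X \<otimes>\<^sub>o (SO (Unit C) \<otimes>\<^sub>o a))"
        using iso_tensor[OF iso_refl[OF xy(1)] iso_sym[OF iso_Shift_Unit_tensor[OF o(1)]]] .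
      also have "isomorphic C (?X \<otimes>\<^sub>o (SO (Unit C) \<otimes>\<^sub>o a)) ((?X \<otimes>\<^sub>o SO (Unit C)) \<otimes>\<^sub>o a)"
        using iso_sym[OF iso_assoc] xy o SO_closed[OF Unit_closed] by blast
      also have "isomorphic C ((?X \<otimes>\<^sub>o SO (Unit C)) \<otimes>\<^sub>o a) (a \<otimes>\<^sub>o (?X \<otimes>\<^sub>o SO (Unit C)))"
        using iso_braid xy o SO_closed[OF Unit_closed] TObj_closed by blast
      finally have i: "isomorphic C (?X \<otimes>\<^sub>o SO a) (a \<otimes>\<^sub>o (?X \<otimes>\<^sub>o SO (Unit C)))" .
      let ?w = "?X \<otimes>\<^sub>o SO (Unit C)"
      have w: "?w \<in> Obj C" using TObj_closed xy SO_closed[OF Unit_closed] by blast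
      have "arr_iso C (Id C (?X \<otimes>\<^sub>o SO a)) (Id C a \<otimes>\<^sub>a Id C ?w)"
        using i arr_iso_Id_iff TArr_Id o w TObj_closed xy by simp
      then have "arr_iso C (tpow C g m \<otimes>\<^sub>a Id C (?X \<otimes>\<^sub>o SO a)) (tpow C g m \<otimes>\<^sub>a (Id C a \<otimes>\<^sub>a Id C ?w))"
        by (rule arr_iso_tensor[OF arr_iso_refl[OF Ga]])
      also have "arr_iso C \<dots> ((tpow C g m \<otimes>\<^sub>a Id C a) \<otimes>\<^sub>a Id C ?w)"
        using arr_iso_sym[OF arr_iso_assoc[OF Ga ia(1) Id_Arr[OF w]]] .
      finally show ?thesis
        using arr_iso_zero zero_arr_tensor[OF TArr_Arr[OF Ga ia(1)] Id_Arr[OF w]] m by blast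
    qed
    let ?k = "Id C ?X \<otimes>\<^sub>a r"
    have o': "?X \<otimes>\<^sub>o SO a \<in> Obj C" "?Y \<otimes>\<^sub>o c \<in> Obj C" using TObj_closed xy o by auto
    have "zero_arr C (tpow C g m \<otimes>\<^sub>a ?k)"
      unfolding tensor_interchange(1)[OF G XH(3)]
      using zero_arr_Comp[OF TArr_closed[OF Id_closed[OF xy(1)] XH(3)] TArr_closed[OF G Id_closed[OF o'(1)]]] mS
      by blast
    \<comment> \<open>By \<open>factor\<close>, this composite is the \<open>m\<close>-th power
      tensored with the \<open>n\<close>-th power on \<open>c\<close>.\<close>
    then have "zero_arr C ((Id C (tpow_obj C y m) \<otimes>\<^sub>a (v \<cdot> \<phi>)) \<cdot> (tpow C g m \<otimes>\<^sub>a ?k))"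
      using zero_arr_Comp[OF TArr_closed[OF G XH(3)] TArr_closed[OF Id_closed[OF xy(2)] v\<phi>]] by blast
    then have "zero_arr C (tpow C g m \<otimes>\<^sub>a (tpow C g n \<otimes>\<^sub>a Id C c))"
      using TArr_Comp[OF G Id_closed[OF xy(2)] XH(3) v\<phi>] factor Id_Comp[OF G] by simp
    moreover have "arr_iso C (tpow C g (m + n) \<otimes>\<^sub>a Id C c) (tpow C g m \<otimes>\<^sub>a (tpow C g n \<otimes>\<^sub>a Id C c))"
      using arr_iso_trans[OF arr_iso_tensor[OF arr_iso_sym[OF tpow_add[OF ga]] arr_iso_refl[OF ia(4)]]
        arr_iso_assoc[OF Ga Ga ia(4)]] .
    ultimately show ?thesis using arr_iso_zero o(3) HomD[OF H(2)] by auto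
  qed
qed

text \<open>As in commutative algebra: Zorn's lemma gives an ideal maximal among those that contain
  \<open>J\<close> and avoid all powers of \<open>x\<close>, and maximality makes it prime.\<close>

lemma prime_avoidance:
  assumes J: "tt_ideal C J" and x: "x \<in> Obj C" and disj: "\<And>m. tpow_obj C x m \<notin> J"
  obtains P where "prime_tt_ideal C P" "J \<subseteq> P" "x \<notin> P"
proof -
  define A where "A = {P. tt_ideal C P \<and> J \<subseteq> P \<and> (\<forall>m. tpow_obj C x m \<notin> P)}"
  have "\<exists>M\<in>A. \<forall>X\<in>A. M \<subseteq> X \<longrightarrow> X = M"
  proof (rule subset_Zorn_nonempty)
    show "A \<noteq> {}" using J disj by (auto simp: A_def)
  next
    fix \<C> assume ne: "\<C> \<noteq> {}" and ch: "subset.chain A \<C>"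
    have sub: "\<C> \<subseteq> A" using ch by (simp add: subset.chain_def)
    then have id: "tt_ideal C P" "thick_subcategory C P" if "P \<in> \<C>" for P
      using that by (auto simp: A_def tt_ideal_def)
    have "tt_ideal C (\<Union>\<C>)"
    proof (rule tt_idealI)
      show "\<Union>\<C> \<subseteq> Obj C" using thick_Obj[OF id(2)] by auto
      show "z \<in> \<Union>\<C>" if "zero_object C z" for z using thick_zero[OF id(2) that] ne by auto
      show "b \<in> \<Union>\<C>" if "a \<in> \<Union>\<C>" "b \<in> Obj C" "isomorphic C a b" for a b
        using thick_iso[OF id(2) that(3) _ that(2)] that(1) by auto
      show "b \<otimes>\<^sub>o a \<in> \<Union>\<C>" if "a \<in> \<Union>\<C>" "b \<in> Obj C" for a b
        using id(1) that by (auto simp: tt_ideal_def)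
      show "b \<in> \<Union>\<C>" if "g \<in> Hom C b c" "v \<in> Hom C c b" "v \<cdot> g = Id C b" "c \<in> \<Union>\<C>" for b c g v
        using thick_retract[OF id(2) that(1-3)] that(4) by auto
      show "Cod C g \<in> \<Union>\<C>"
        if T: "(f, g, h) \<in> Tri C" and U: "Dom C f \<in> \<Union>\<C>" "Cod C f \<in> \<Union>\<C>" for f g h
      proof -
        obtain P Q where PQ: "P \<in> \<C>" "Dom C f \<in> P" "Q \<in> \<C>" "Cod C f \<in> Q" using U by blast
        then have "P \<subseteq> Q \<or> Q \<subseteq> P" using ch by (auto simp: subset_chain_def)
        then obtain R where "R \<in> \<C>" "Dom C f \<in> R" "Cod C f \<in> R" using PQ by blast
        then show ?thesis using thick_cone[OF id(2)[OF \<open>R \<in> \<C>\<close>] T] by auto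
      qed
    qed
    then show "\<Union>\<C> \<in> A" using sub ne by (auto simp: A_def)
  qed
  then obtain P where PA: "P \<in> A" and max: "\<And>X. X \<in> A \<Longrightarrow> P \<subseteq> X \<Longrightarrow> X = P" by auto
  have P: "tt_ideal C P" "J \<subseteq> P" "\<And>m. tpow_obj C x m \<notin> P" using PA by (simp_all add: A_def)
  have th: "thick_subcategory C P" using P by (simp add: tt_ideal_def)
  note powers = tpow_obj_closed[OF x]
  \<comment> \<open>The ideal quotient \<open>P : b\<close> contains \<open>P\<close> and also
    \<open>a\<close>, so it is strictly larger and, by maximality, contains a power of
    \<open>x\<close>.\<close>
  have meets: "\<exists>m. tpow_obj C x m \<otimes>\<^sub>o b \<in> P" if ab: "a \<in> Obj C" "b \<in> Obj C" "a \<notin> P" "a \<otimes>\<^sub>o b \<in> P" for a b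
  proof (rule ccontr)
    assume n: "\<not> ?thesis"
    let ?X = "{c \<in> Obj C. c \<otimes>\<^sub>o b \<in> P}"
    have PX: "P \<subseteq> ?X" using P(1) thick_Obj[OF th] ab by (auto simp: tt_ideal_def)
    have "?X \<in> A" using colon_ideal[OF P(1) ab(2)] order_trans[OF P(2) PX] n by (simp add: A_def)
    then show False using max[OF _ PX] ab by blast
  qed
  have pr: "a \<in> P \<or> b \<in> P" if ab: "a \<in> Obj C" "b \<in> Obj C" "a \<otimes>\<^sub>o b \<in> P" for a b
  proof (rule ccontr)
    assume n: "\<not> ?thesis"
    \<comment> \<open>\<open>meets\<close> is used twice: first a power of \<open>x\<close> replaces
      \<open>a\<close>, then another one replaces \<open>b\<close>. The product of the two is a
      power of \<open>x\<close> in \<open>P\<close>.\<close>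
    obtain m where "tpow_obj C x m \<otimes>\<^sub>o b \<in> P" using meets[OF ab(1,2) _ ab(3)] n by blast
    then have "b \<otimes>\<^sub>o tpow_obj C x m \<in> P"
      using thick_iso[OF th iso_braid[OF powers ab(2)]] powers ab TObj_closed by simp
    then obtain k where "tpow_obj C x k \<otimes>\<^sub>o tpow_obj C x m \<in> P"
      using meets[OF ab(2) powers] n by blast
    then show False using thick_iso[OF th tpow_obj_add[OF x] _ powers] P(3) by simp
  qed
  \<comment> \<open>Exponent 0 gives properness; exponent 1, which is \<open>x\<close> tensored with
    the unit, keeps \<open>x\<close> itself out of \<open>P\<close>.\<close>
  have "Unit C \<notin> P" using P(3)[of 0] by simp
  then have "P \<noteq> Obj C" using Unit_closed by blast
  then have "prime_tt_ideal C P" using P(1) pr by (simp add: prime_tt_ideal_def)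
  moreover have "x \<notin> P"
    using P(1) P(3)[of 1] Unit_closed by (auto simp: tt_ideal_def)
  ultimately show ?thesis using that P(2) by blast
qed

text \<open>One vanishing power suffices, since later powers contain it as a tensor factor.\<close>

lemma tensor_nilpotentI:
  assumes g: "g \<in> Hom C x y" and z: "zero_arr C (tpow C g N)"
  shows "tensor_nilpotent C g"
proof -
  have ga: "g \<in> Arr C" using HomD[OF g] by simp
  have "zero_arr C (tpow C g (N + k))" for k
    using arr_iso_zero[OF arr_iso_sym[OF tpow_add[OF ga]]] zero_arr_tensor tpow_Arr[OF ga] z by blast
  then have "zero_arr C (tpow C g s)" if "s \<ge> N" for s
    using that le_Suc_ex by blast
  then show ?thesis
    using zero_arr_iff[OF tpow_closed[OF g]] HomD[OF g] unfolding tensor_nilpotent_def by metis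
qed

lemma tensor_nilpotentE:
  assumes g: "g \<in> Hom C x y" and n: "tensor_nilpotent C g"
  obtains N where "zero_arr C (tpow C g N)"
  using n zero_arr_iff[OF tpow_closed[OF g]] HomD[OF g] unfolding tensor_nilpotent_def by blast

text \<open>
  The objects annihilated by some power of \<open>g\<close> form an ideal containing \<open>k\<close>. It contains a power
  \<open>x\<^sup>m\<close>, since otherwise it could be enlarged to a prime avoiding \<open>x\<close>; and \<open>g\<^sup>n \<otimes> x\<^sup>m = 0\<close>
  forces \<open>g\<^sup>n \<otimes> g\<^sup>m = 0\<close>.
\<close>

lemma tensor_nilpotent_if_supp:
  assumes g: "g \<in> Hom C x y" and k: "k \<in> Obj C" "zero_arr C (g \<otimes>\<^sub>a Id C k)"
    and supp: "\<And>P. prime_tt_ideal C P \<Longrightarrow> k \<in> P \<Longrightarrow> x \<in> P"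
  shows "tensor_nilpotent C g"
proof -
  define J where "J = {a \<in> Obj C. \<exists>n. zero_arr C (tpow C g n \<otimes>\<^sub>a Id C a)}"
  have ga: "g \<in> Arr C" and x: "x \<in> Obj C" using HomD[OF g] by simp_all
  note G = tpow_closed[OF g] and Ga = tpow_Arr[OF ga]
  have J: "tt_ideal C J" unfolding J_def by (rule annihilator_ideal[OF g])
  \<comment> \<open>The first power is \<open>g\<close> with the unit on its right; a braiding
    brings it into the form of the left unitor.\<close>
  have "arr_iso C (tpow C g 1 \<otimes>\<^sub>a Id C k) (g \<otimes>\<^sub>a Id C k)"
    using arr_iso_tensor[OF arr_iso_trans[OF arr_iso_braid arr_iso_lunit] arr_iso_refl] ga Id_Arr Unit_closed k
    by simp
  then have kJ: "k \<in> J" using arr_iso_zero k unfolding J_def by blast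
  have "\<exists>m. tpow_obj C x m \<in> J"
  proof (rule ccontr)
    assume "\<not> ?thesis"
    then obtain P where "prime_tt_ideal C P" "J \<subseteq> P" "x \<notin> P" using prime_avoidance[OF J x] by blast
    then show False using supp kJ by blast
  qed
  then obtain m n where z: "zero_arr C (tpow C g n \<otimes>\<^sub>a Id C (tpow_obj C x m))" by (auto simp: J_def)
  have o: "tpow_obj C x m \<in> Obj C" "tpow_obj C y n \<in> Obj C" using tpow_obj_closed HomD[OF g] by simp_all
  have "zero_arr C (tpow C g n \<otimes>\<^sub>a tpow C g m)"
    unfolding tensor_interchange(2)[OF G G]
    using zero_arr_Comp[OF TArr_closed[OF G Id_closed[OF o(1)]] TArr_closed[OF Id_closed[OF o(2)] G]] z
    by blast
  then have "zero_arr C (tpow C g (n + m))" using arr_iso_zero[OF arr_iso_sym[OF tpow_add[OF ga]]] by blast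
  then show ?thesis by (rule tensor_nilpotentI[OF g])
qed

end


section \<open>The nilpotence test in a rigid category\<close>

context tt_category
begin

lemma Unit_notin_prime:
  assumes "prime_tt_ideal C P" shows "Unit C \<notin> P"
proof
  assume U: "Unit C \<in> P"
  have P: "tt_ideal C P" "thick_subcategory C P" "P \<noteq> Obj C"
    using assms by (auto simp: prime_tt_ideal_def tt_ideal_def)
  have "a \<in> P" if "a \<in> Obj C" for a
    using thick_iso[OF P(2) iso_lunit[OF that] _ that] P(1) U that by (simp add: tt_ideal_def)
  then show False using P(3) thick_Obj[OF P(2)] by blast
qed

lemma prime_tpow_obj:
  assumes P: "prime_tt_ideal C P" and a: "a \<in> Obj C"
  shows "tpow_obj C a n \<in> P \<Longrightarrow> a \<in> P"
proof (induction n)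
  case 0
  then show ?case using Unit_notin_prime[OF P] by simp
next
  case (Suc n)
  then show ?case using P a tpow_obj_closed[OF a, of n] by (auto simp: prime_tt_ideal_def)
qed

lemma cone_in_tensor:
  assumes P: "tt_ideal C P" and x: "x \<in> Obj C" and f: "f \<in> Hom C a b" "cone_in C P f"
  shows "cone_in C P (f \<otimes>\<^sub>a Id C x)" and "cone_in C P (Id C x \<otimes>\<^sub>a f)"
proof -
  obtain g h where T: "(f, g, h) \<in> Tri C" and P': "Cod C g \<in> P" using f by (auto simp: cone_in_def)
  obtain c where g: "g \<in> Hom C b c" using TriE[OF T] HomD[OF f(1)] HomD by metis
  have c: "c \<otimes>\<^sub>o x \<in> P" "x \<otimes>\<^sub>o c \<in> P" using P P' HomD[OF g] x by (auto simp: tt_ideal_def)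
  have "Cod C (g \<otimes>\<^sub>a Id C x) \<in> P" "Cod C (Id C x \<otimes>\<^sub>a g) \<in> P"
    using c HomD[OF TArr_closed[OF g Id_closed[OF x]]] HomD[OF TArr_closed[OF Id_closed[OF x] g]] by simp_all
  then show "cone_in C P (f \<otimes>\<^sub>a Id C x)" "cone_in C P (Id C x \<otimes>\<^sub>a f)"
    using Tri_tensor_right[OF x T] Tri_tensor_left[OF x T] unfolding cone_in_def by metis+
qed

text \<open>Each further factor is split off by interchange. Both pieces have their cone in
  \<open>P\<close> by exactness, and such arrows compose.\<close>

lemma cone_in_tpow:
  assumes P: "tt_ideal C P" and f: "f \<in> Hom C a b" "cone_in C P f"
  shows "cone_in C P (tpow C f n)"
proof (induction n)
  have th: "thick_subcategory C P" using P by (simp add: tt_ideal_def)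
  {
    case 0
    show ?case using cone_in_Id[OF th Unit_closed] by simp
  next
    case (Suc n)
    note G = tpow_closed[OF f(1), of n]
    have o: "a \<in> Obj C" "tpow_obj C b n \<in> Obj C" using HomD[OF f(1)] HomD[OF G] by auto
    show ?case
      using cone_in_Comp[OF th TArr_closed[OF Id_closed[OF o(1)] G] TArr_closed[OF f(1) Id_closed[OF o(2)]]]
        cone_in_tensor(2)[OF P o(1) G Suc] cone_in_tensor(1)[OF P o(2) f]
        tensor_interchange(1)[OF f(1) G] by simp
  }
qed

text \<open>A vanishing power of \<open>f\<close> still has its cone in \<open>P\<close>, so its
  target, a power of \<open>b\<close>, is a summand of an object of \<open>P\<close>.\<close>

lemma prime_nilpotent:
  assumes P: "prime_tt_ideal C P" and f: "f \<in> Hom C a b" "cone_in C P f" "tensor_nilpotent C f"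
  shows "b \<in> P"
proof -
  have id: "tt_ideal C P" "thick_subcategory C P"
    using P by (auto simp: prime_tt_ideal_def tt_ideal_def)
  obtain n where n: "zero_arr C (tpow C f n)" using tensor_nilpotentE[OF f(1,3)] .
  obtain g h where T: "(tpow C f n, g, h) \<in> Tri C" "Cod C g \<in> P"
    using cone_in_tpow[OF id(1) f(1,2), of n] by (auto simp: cone_in_def)
  have "tpow_obj C b n \<in> P"
    using thick_zero_arr[OF id(2) T(1) n T(2)] HomD[OF tpow_closed[OF f(1)]] by simp
  then show ?thesis using prime_tpow_obj[OF P] HomD[OF f(1)] by blast
qed

text \<open>
  The connecting morphism \<open>h\<close> of the coevaluation \<open>1 \<rightarrow> k \<otimes> d\<close> is killed by \<open>k\<close>, because
  the coevaluation becomes a split monomorphism after tensoring with \<open>k\<close>, and its cone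
  \<open>\<Sigma>(k \<otimes> d)\<close> belongs to every ideal containing \<open>k\<close>.
\<close>

lemma coevaluation_cone:
  assumes "is_dual C k d"
  obtains c h where "h \<in> Hom C c (SO (Unit C))" "zero_arr C (h \<otimes>\<^sub>a Id C k)"
    "\<And>P. tt_ideal C P \<Longrightarrow> k \<in> P \<Longrightarrow> cone_in C P h"
proof -
  have o: "k \<in> Obj C" "d \<in> Obj C" using assms by (auto simp: is_dual_def)
  obtain ev coev where ev: "ev \<in> Hom C (d \<otimes>\<^sub>o k) (Unit C)" and coev: "coev \<in> Hom C (Unit C) (k \<otimes>\<^sub>o d)"
    and zigzag: "runit C k \<cdot> (Id C k \<otimes>\<^sub>a ev) \<cdot> assoc C k d k \<cdot> (coev \<otimes>\<^sub>a Id C k) \<cdot> Inv C (lunit C k) = Id C k"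
    using assms unfolding is_dual_def by blast
  obtain g h where T: "(coev, g, h) \<in> Tri C" using Tri_cone HomD[OF coev] by blast
  obtain c where h: "h \<in> Hom C c (SO (Unit C))" using TriE[OF T] HomD[OF coev] HomD by metis
  let ?r = "runit C k" and ?e = "Id C k \<otimes>\<^sub>a ev" and ?a = "assoc C k d k" and ?q = "coev \<otimes>\<^sub>a Id C k"
    and ?l = "Inv C (lunit C k)"
  have r: "?r \<in> Hom C (k \<otimes>\<^sub>o Unit C) k" using runit_closed o by blast
  have e: "?e \<in> Hom C (k \<otimes>\<^sub>o (d \<otimes>\<^sub>o k)) (k \<otimes>\<^sub>o Unit C)" using TArr_closed[OF Id_closed[OF o(1)] ev] .
  have a: "?a \<in> Hom C ((k \<otimes>\<^sub>o d) \<otimes>\<^sub>o k) (k \<otimes>\<^sub>o (d \<otimes>\<^sub>o k))" using assoc_closed o by blast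
  have q: "?q \<in> Hom C (Unit C \<otimes>\<^sub>o k) ((k \<otimes>\<^sub>o d) \<otimes>\<^sub>o k)" using TArr_closed[OF coev Id_closed[OF o(1)]] .
  have lu: "lunit C k \<in> Hom C (Unit C \<otimes>\<^sub>o k) k" "is_iso C (lunit C k)" using lunit_closed o by auto
  have l: "?l \<in> Hom C k (Unit C \<otimes>\<^sub>o k)" "?l \<cdot> lunit C k = Id C (Unit C \<otimes>\<^sub>o k)"
    using Inv_iso[OF lu(2,1)] by auto
  \<comment> \<open>\<open>R\<close> is what follows \<open>?q\<close> in the zig-zag. The identity
    says that \<open>R \<cdot> ?q\<close> is the left unitor, so \<open>?l \<cdot> R\<close> is a
    retraction of \<open>?q\<close>.\<close>
  define R where "R = ?r \<cdot> (?e \<cdot> ?a)"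
  have R: "R \<in> Hom C ((k \<otimes>\<^sub>o d) \<otimes>\<^sub>o k) k"
    unfolding R_def using Comp_closed[OF Comp_closed[OF a e] r] .
  have Rq: "R \<cdot> ?q \<in> Hom C (Unit C \<otimes>\<^sub>o k) k" using Comp_closed[OF q R] .
  have "R \<cdot> (?q \<cdot> ?l) = Id C k"
    unfolding R_def
    using Comp_assoc[OF Comp_closed[OF l(1) q] Comp_closed[OF a e] r]
      Comp_assoc[OF Comp_closed[OF l(1) q] a e] zigzag by simp
  then have "(R \<cdot> ?q) \<cdot> ?l = Id C k" using Comp_assoc[OF l(1) q R] by simp
  then have "R \<cdot> ?q = lunit C k"
    using Comp_assoc[OF lu(1) l(1) Rq] l(2) Comp_Id[OF Rq] Id_Comp[OF lu(1)] by simp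
  then have split: "(?l \<cdot> R) \<cdot> ?q = Id C (Unit C \<otimes>\<^sub>o k)" using Comp_assoc[OF q R l(1)] l(2) by simp
  obtain \<phi> where T': "(?q, g \<otimes>\<^sub>a Id C k, \<phi> \<cdot> (h \<otimes>\<^sub>a Id C k)) \<in> Tri C"
    and \<phi>: "\<phi> \<in> Hom C (SO (Unit C) \<otimes>\<^sub>o k) (SO (Unit C \<otimes>\<^sub>o k))" "is_iso C \<phi>"
    using Tri_tensor_right[OF o(1) T] HomD[OF coev] by metis
  have "zero_arr C (\<phi> \<cdot> (h \<otimes>\<^sub>a Id C k))"
    by (rule Tri_split_mono_zero[OF T' q Comp_closed[OF R l(1)] split])
  then have z: "zero_arr C (h \<otimes>\<^sub>a Id C k)"
    by (rule zero_arr_iso_cancel[OF TArr_closed[OF h Id_closed[OF o(1)]] \<phi>])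
  have cone: "cone_in C P h" if P: "tt_ideal C P" "k \<in> P" for P
  proof -
    have th: "thick_subcategory C P" using P by (simp add: tt_ideal_def)
    have "k \<otimes>\<^sub>o d \<in> P" using P o by (simp add: tt_ideal_def)
    then have "SO (k \<otimes>\<^sub>o d) \<in> P" using thick_Shift[OF th] TObj_closed o by blast
    then have "Cod C (Neg C (SA coev)) \<in> P" using HomD[OF Neg_Hom(1)[OF SA_closed[OF coev]]] by simp
    then show ?thesis using Tri_rot[OF Tri_rot[OF T]] unfolding cone_in_def by blast
  qed
  show ?thesis by (rule that[OF h z cone])
qed

text \<open>Tensor the arrow \<open>h\<close> of \<open>coevaluation_cone\<close> with
  \<open>l\<close>. The source keeps the form \<open>c \<otimes>\<^sub>o l\<close> so that each
  ideal containing \<open>l\<close> contains it, also after applying a tt-functor.\<close>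

lemma rigid_test_morphism:
  assumes "rigid C" and k: "k \<in> Obj C" and l: "l \<in> Obj C"
  obtains c y f where "c \<in> Obj C" "f \<in> Hom C (c \<otimes>\<^sub>o l) y" "zero_arr C (f \<otimes>\<^sub>a Id C k)"
    "\<And>P. prime_tt_ideal C P \<Longrightarrow> k \<in> P \<Longrightarrow> tensor_nilpotent C f \<Longrightarrow> l \<in> P"
proof -
  obtain d where "is_dual C k d" using assms(1) k by (auto simp: rigid_def)
  then obtain c h where h: "h \<in> Hom C c (SO (Unit C))" "zero_arr C (h \<otimes>\<^sub>a Id C k)"
    "\<And>P. tt_ideal C P \<Longrightarrow> k \<in> P \<Longrightarrow> cone_in C P h"
    using coevaluation_cone by blast
  have f: "h \<otimes>\<^sub>a Id C l \<in> Hom C (c \<otimes>\<^sub>o l) (SO (Unit C) \<otimes>\<^sub>o l)" using TArr_closed[OF h(1) Id_closed[OF l]] .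
  have i: "h \<in> Arr C" "Id C l \<in> Arr C" "Id C k \<in> Arr C" using HomD[OF h(1)] Id_Arr k l by auto
  have "arr_iso C ((h \<otimes>\<^sub>a Id C l) \<otimes>\<^sub>a Id C k) (h \<otimes>\<^sub>a (Id C l \<otimes>\<^sub>a Id C k))" using arr_iso_assoc[OF i] .
  also have "arr_iso C \<dots> (h \<otimes>\<^sub>a (Id C k \<otimes>\<^sub>a Id C l))"
    using arr_iso_tensor[OF arr_iso_refl[OF i(1)] arr_iso_braid[OF i(2,3)]] .
  also have "arr_iso C \<dots> ((h \<otimes>\<^sub>a Id C k) \<otimes>\<^sub>a Id C l)" using arr_iso_sym[OF arr_iso_assoc[OF i(1,3,2)]] .
  finally have z: "zero_arr C ((h \<otimes>\<^sub>a Id C l) \<otimes>\<^sub>a Id C k)"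
    using arr_iso_zero zero_arr_tensor[OF TArr_Arr[OF i(1,3)] i(2)] h(2) by blast
  have "l \<in> P" if P: "prime_tt_ideal C P" "k \<in> P" and n: "tensor_nilpotent C (h \<otimes>\<^sub>a Id C l)" for P
  proof -
    have id: "tt_ideal C P" "thick_subcategory C P"
      using P by (auto simp: prime_tt_ideal_def tt_ideal_def)
    have "SO (Unit C) \<otimes>\<^sub>o l \<in> P"
      using prime_nilpotent[OF P(1) f cone_in_tensor(1)[OF id(1) l h(1) h(3)[OF id(1) P(2)]] n] .
    \<comment> \<open>The first alternative is impossible: desuspending would put the unit into
      \<open>P\<close>.\<close>
    then have "SO (Unit C) \<in> P \<or> l \<in> P"
      using P(1) l SO_closed[OF Unit_closed] by (simp add: prime_tt_ideal_def)
    then show ?thesis using thick_Shift[OF id(2) Unit_closed] Unit_notin_prime[OF P(1)] by blast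
  qed
  then show ?thesis using that[OF _ f z] HomD[OF h(1)] by blast
qed

end


section \<open>Functoriality of the spectrum\<close>

text \<open>Naturality of \<open>mu\<close> is exactly the required commutative square.\<close>

lemma tt_functor_arr_iso_tensor:
  assumes D: "tt_category D" and F: "tt_functor C D F" and fg: "f \<in> Hom C a b" "g \<in> Hom C a' b'"
    and ob: "a \<in> Obj C" "b \<in> Obj C" "a' \<in> Obj C" "b' \<in> Obj C"
    and "f \<otimes>\<^sub>a\<^bsub>C\<^esub> g \<in> Hom C (a \<otimes>\<^sub>o\<^bsub>C\<^esub> a') (b \<otimes>\<^sub>o\<^bsub>C\<^esub> b')"
  shows "arr_iso D (amap F f \<otimes>\<^sub>a\<^bsub>D\<^esub> amap F g) (amap F (f \<otimes>\<^sub>a\<^bsub>C\<^esub> g))"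
proof -
  interpret D: tt_category D by fact
  have fun_F: "is_functor C D F" and smf: "symmetric_monoidal_functor C D F"
    using F by (simp_all add: tt_functor_def symmetric_monoidal_functor_def)
  have mu: "mu F a a' \<in> Hom D (omap F a \<otimes>\<^sub>o\<^bsub>D\<^esub> omap F a') (omap F (a \<otimes>\<^sub>o\<^bsub>C\<^esub> a'))" "is_iso D (mu F a a')"
    "mu F b b' \<in> Hom D (omap F b \<otimes>\<^sub>o\<^bsub>D\<^esub> omap F b') (omap F (b \<otimes>\<^sub>o\<^bsub>C\<^esub> b'))" "is_iso D (mu F b b')"
    using smf ob unfolding symmetric_monoidal_functor_def by blast+
  have "mu F (Cod C f) (Cod C g) \<cdot>\<^bsub>D\<^esub> (amap F f \<otimes>\<^sub>a\<^bsub>D\<^esub> amap F g)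
      = amap F (f \<otimes>\<^sub>a\<^bsub>C\<^esub> g) \<cdot>\<^bsub>D\<^esub> mu F (Dom C f) (Dom C g)"
    using smf fg unfolding symmetric_monoidal_functor_def Hom_def by blast
  then have sq: "mu F b b' \<cdot>\<^bsub>D\<^esub> (amap F f \<otimes>\<^sub>a\<^bsub>D\<^esub> amap F g) = amap F (f \<otimes>\<^sub>a\<^bsub>C\<^esub> g) \<cdot>\<^bsub>D\<^esub> mu F a a'"
    using fg by (simp add: Hom_def)
  show ?thesis
    by (rule D.arr_isoI[OF D.TArr_closed[OF functor_Hom[OF fun_F fg(1)] functor_Hom[OF fun_F fg(2)]]
      functor_Hom[OF fun_F assms(9)] mu(1,3,2,4) sq])
qed

lemma tt_functor_iso_tensor:
  assumes "tt_category D" "tt_functor C D F" "a \<in> Obj C" "b \<in> Obj C"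
  shows "isomorphic D (omap F a \<otimes>\<^sub>o\<^bsub>D\<^esub> omap F b) (omap F (a \<otimes>\<^sub>o\<^bsub>C\<^esub> b))"
  using assms unfolding tt_functor_def symmetric_monoidal_functor_def isomorphic_def by blast

text \<open>So \<open>Spc_map\<close> lands in the spectrum. Triangles and retracts are carried
  forward by \<open>F\<close>; \<open>mu\<close> compares tensor products, and \<open>eps\<close>
  keeps the unit out of the preimage.\<close>

lemma prime_Spc_map:
  assumes C: "tt_category C" and D: "tt_category D" and F: "tt_functor C D F" and Q: "prime_tt_ideal D Q"
  shows "prime_tt_ideal C (Spc_map C F Q)"
proof -
  interpret C: tt_category C by fact
  interpret D: tt_category D by fact
  have fun_F: "is_functor C D F" and add_F: "additive_functor C D F"
    using F by (simp_all add: tt_functor_def symmetric_monoidal_functor_def exact_functor_def)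
  have id: "tt_ideal D Q" "thick_subcategory D Q"
    using Q by (simp_all add: prime_tt_ideal_def tt_ideal_def)
  note Ft = tt_functor_iso_tensor[OF D F]
  note Fo = functor_Obj[OF fun_F] and Fh = functor_Hom[OF fun_F]
  have "tt_ideal C (Spc_map C F Q)"
  proof (rule C.tt_idealI)
    show "Spc_map C F Q \<subseteq> Obj C" by (auto simp: Spc_map_def)
    show "z \<in> Spc_map C F Q" if "zero_object C z" for z
      using thick_zero[OF id(2) additive_functor_zero_object[OF C.additive D.additive add_F that]] that
      by (simp add: Spc_map_def zero_object_def)
    show "b \<in> Spc_map C F Q" if "a \<in> Spc_map C F Q" "b \<in> Obj C" "isomorphic C a b" for a b
      using thick_iso[OF id(2) functor_isomorphic[OF C.category_axioms D.category_axioms fun_F that(3)]]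
        that Fo by (simp add: Spc_map_def)
    show "b \<otimes>\<^sub>o\<^bsub>C\<^esub> a \<in> Spc_map C F Q" if "a \<in> Spc_map C F Q" "b \<in> Obj C" for a b
    proof -
      have a: "a \<in> Obj C" "omap F a \<in> Q" using that by (auto simp: Spc_map_def)
      have "omap F b \<otimes>\<^sub>o\<^bsub>D\<^esub> omap F a \<in> Q" using id(1) a that Fo by (simp add: tt_ideal_def)
      then show ?thesis
        using thick_iso[OF id(2) Ft[OF that(2) a(1)]] Fo C.TObj_closed a that by (simp add: Spc_map_def)
    qed
    show "Cod C g \<in> Spc_map C F Q"
      if T: "(f, g, h) \<in> Tri C" and J: "Dom C f \<in> Spc_map C F Q" "Cod C f \<in> Spc_map C F Q" for f g h
    proof -
      obtain a b c where H: "f \<in> Hom C a b" "g \<in> Hom C b c" using C.TriE[OF T] by blast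
      have "exact_functor C D F" using F by (simp add: tt_functor_def)
      then obtain h' where "(amap F f, amap F g, h') \<in> Tri D"
        using T unfolding exact_functor_def by blast
      from thick_cone[OF id(2) this] show ?thesis
        using J C.HomD[OF H(1)] C.HomD[OF H(2)] D.HomD[OF Fh[OF H(1)]] D.HomD[OF Fh[OF H(2)]]
        by (simp add: Spc_map_def)
    qed
    show "b \<in> Spc_map C F Q"
      if H: "g \<in> Hom C b c" "v \<in> Hom C c b" "v \<cdot>\<^bsub>C\<^esub> g = Id C b" "c \<in> Spc_map C F Q" for b c g v
    proof -
      have b: "b \<in> Obj C" using C.HomD[OF H(1)] by simp
      have "amap F v \<cdot>\<^bsub>D\<^esub> amap F g = Id D (omap F b)"
        using functor_Comp[OF fun_F H(1,2)] functor_Id[OF fun_F b] H(3) by simp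
      then show ?thesis
        using D.thick_retract[OF id(2) Fh[OF H(1)] Fh[OF H(2)]] H(4) b by (simp add: Spc_map_def)
    qed
  qed
  moreover have "Unit C \<notin> Spc_map C F Q"
  proof
    assume "Unit C \<in> Spc_map C F Q"
    then have U: "omap F (Unit C) \<in> Q" by (simp add: Spc_map_def)
    have "isomorphic D (Unit D) (omap F (Unit C))"
      using F unfolding tt_functor_def symmetric_monoidal_functor_def isomorphic_def by blast
    then have "Unit D \<in> Q" using thick_iso[OF id(2) D.iso_sym U D.Unit_closed] by blast
    then show False using D.Unit_notin_prime[OF Q] by simp
  qed
  moreover have "k \<in> Spc_map C F Q \<or> l \<in> Spc_map C F Q"
    if "k \<in> Obj C" "l \<in> Obj C" "k \<otimes>\<^sub>o\<^bsub>C\<^esub> l \<in> Spc_map C F Q" for k l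
  proof -
    have kl: "omap F (k \<otimes>\<^sub>o\<^bsub>C\<^esub> l) \<in> Q" using that by (simp add: Spc_map_def)
    have "omap F k \<otimes>\<^sub>o\<^bsub>D\<^esub> omap F l \<in> Q"
      using thick_iso[OF id(2) D.iso_sym[OF Ft[OF that(1,2)]] kl] D.TObj_closed Fo that by blast
    then have "omap F k \<in> Q \<or> omap F l \<in> Q" using Q Fo that by (simp add: prime_tt_ideal_def)
    then show ?thesis using that by (simp add: Spc_map_def)
  qed
  ultimately show ?thesis using C.Unit_closed unfolding prime_tt_ideal_def by blast
qed

text \<open>\<open>tensor_nilpotent_if_supp\<close> applies to the image of \<open>f\<close>:
  tensored with \<open>omap F k\<close> it is isomorphic to the image of a zero arrow, and its
  source is a multiple of \<open>omap F l\<close>, which \<open>supp\<close> places in every prime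
  containing \<open>omap F k\<close>.\<close>

lemma tt_functor_nilpotent:
  assumes C: "tt_category C" and D: "tt_category D" and F: "tt_functor C D F"
    and k: "k \<in> Obj C" and c: "c \<in> Obj C" and l: "l \<in> Obj C"
    and f: "f \<in> Hom C (c \<otimes>\<^sub>o\<^bsub>C\<^esub> l) y" and z: "zero_arr C (f \<otimes>\<^sub>a\<^bsub>C\<^esub> Id C k)"
    and supp: "\<And>Q. prime_tt_ideal D Q \<Longrightarrow> omap F k \<in> Q \<Longrightarrow> omap F l \<in> Q"
  shows "tensor_nilpotent D (amap F f)"
proof -
  interpret C: tt_category C by fact
  interpret D: tt_category D by fact
  have fun_F: "is_functor C D F" and add_F: "additive_functor C D F"
    using F by (simp_all add: tt_functor_def symmetric_monoidal_functor_def exact_functor_def)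
  note Fo = functor_Obj[OF fun_F]
  show ?thesis
  proof (rule D.tensor_nilpotent_if_supp[OF functor_Hom[OF fun_F f]])
    show "omap F k \<in> Obj D" using Fo k by simp
    have "arr_iso D (amap F f \<otimes>\<^sub>a\<^bsub>D\<^esub> amap F (Id C k)) (amap F (f \<otimes>\<^sub>a\<^bsub>C\<^esub> Id C k))"
      using C.HomD[OF f] k
      by (intro tt_functor_arr_iso_tensor[OF D F f C.Id_closed[OF k]] C.TArr_closed[OF f C.Id_closed[OF k]])
        simp_all
    then show "zero_arr D (amap F f \<otimes>\<^sub>a\<^bsub>D\<^esub> Id D (omap F k))"
      using D.arr_iso_zero additive_functor_zero[OF C.additive D.additive add_F z] functor_Id[OF fun_F k] by simp
    show "omap F (c \<otimes>\<^sub>o\<^bsub>C\<^esub> l) \<in> Q" if Q: "prime_tt_ideal D Q" "omap F k \<in> Q" for Q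
    proof -
      have id: "tt_ideal D Q" "thick_subcategory D Q" using Q by (simp_all add: prime_tt_ideal_def tt_ideal_def)
      have "omap F c \<otimes>\<^sub>o\<^bsub>D\<^esub> omap F l \<in> Q" using id(1) supp[OF Q] Fo c by (simp add: tt_ideal_def)
      then show ?thesis
        using thick_iso[OF id(2) tt_functor_iso_tensor[OF D F c l]] Fo C.TObj_closed c l by blast
    qed
  qed
qed


section \<open>Constructible neighbourhoods\<close>

lemma topspace_patch_topology: "topspace (patch_topology X) = topspace X"
proof -
  have "openin X {} \<and> compactin X {}" by simp
  then have "topspace X \<in> {topspace X - U | U. openin X U \<and> compactin X U}" by blast
  moreover have "U \<subseteq> topspace X" if "openin X U" for U using openin_subset that .
  ultimately show ?thesis
    unfolding patch_topology_def topology_generated_by_topspace by blast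
qed

context tt_category
begin

text \<open>The complement of \<open>supp C k\<close>, hence a generating open set of the
  spectrum.\<close>

abbreviation primes_over where "primes_over k \<equiv> {P. prime_tt_ideal C P \<and> k \<in> P}"

lemma openin_primes_over: "k \<in> Obj C \<Longrightarrow> openin (Spc C) (primes_over k)"
proof -
  assume k: "k \<in> Obj C"
  have "primes_over k = {P. prime_tt_ideal C P} - supp C k" by (auto simp: supp_def)
  then show ?thesis unfolding Spc_def using k by (intro topology_generated_by_Basis) blast
qed

text \<open>The cone of the zero morphism \<open>k \<rightarrow> k'\<close> is \<open>\<Sigma>k \<oplus> k'\<close>.\<close>

lemma ex_thick_both:
  assumes k: "k \<in> Obj C" "k' \<in> Obj C"
  obtains m where "m \<in> Obj C" "\<And>P. thick_subcategory C P \<Longrightarrow> m \<in> P \<longleftrightarrow> k \<in> P \<and> k' \<in> P"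
proof -
  have Z: "Zer C k k' \<in> Hom C k k'" "zero_arr C (Zer C k k')" using Zer_Hom zero_arr_Zer k by auto
  obtain g h where T: "(Zer C k k', g, h) \<in> Tri C" using Tri_cone HomD[OF Z(1)] by blast
  have m: "Cod C g \<in> Obj C" using Tri_triangle[OF T] Cod_closed by (simp add: triangle_def)
  have "Cod C g \<in> P \<longleftrightarrow> k \<in> P \<and> k' \<in> P" if P: "thick_subcategory C P" for P
    using thick_cone[OF P T] thick_zero_arr[OF P T Z(2)] thick_dom[OF P T] HomD[OF Z(1)] by auto
  then show ?thesis using that m by blast
qed

section \<open>Bases of the spectrum and of its patch topology\<close>

lemma prime_thick: "prime_tt_ideal C P \<Longrightarrow> thick_subcategory C P"
  by (simp add: prime_tt_ideal_def tt_ideal_def)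

lemma prime_tensor_iff:
  assumes "prime_tt_ideal C P" "k \<in> Obj C" "l \<in> Obj C"
  shows "k \<otimes>\<^sub>o l \<in> P \<longleftrightarrow> k \<in> P \<or> l \<in> P"
  using assms by (auto simp: prime_tt_ideal_def tt_ideal_def)

lemma ex_zero_obj_in_primes: obtains z where "z \<in> Obj C" "\<And>P. prime_tt_ideal C P \<Longrightarrow> z \<in> P"
proof -
  obtain z where z: "zero_object C z" using ex_zero_object by blast
  then have "z \<in> Obj C" by (simp add: zero_object_def)
  then show ?thesis using that thick_zero[OF prime_thick z] by simp
qed

text \<open>The generating sets already form a basis, since \<open>ex_thick_both\<close> represents
  a binary intersection by a single object.\<close>

lemma Spc_nbhd:
  assumes "openin (Spc C) U" "P \<in> U"
  shows "\<exists>k \<in> Obj C. P \<in> primes_over k \<and> primes_over k \<subseteq> U"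
proof -
  let ?S = "{{P. prime_tt_ideal C P} - supp C k | k. k \<in> Obj C}"
  have "generate_topology_on ?S U" using assms(1) by (simp add: Spc_def openin_topology_generated_by_iff)
  then show ?thesis using assms(2)
  proof (induction arbitrary: P rule: generate_topology_on.induct)
    case Empty
    then show ?case by simp
  next
    case (Int U V)
    obtain k where k: "k \<in> Obj C" "P \<in> primes_over k" "primes_over k \<subseteq> U" using Int.IH(1) Int.prems by blast
    obtain k' where k': "k' \<in> Obj C" "P \<in> primes_over k'" "primes_over k' \<subseteq> V" using Int.IH(2) Int.prems by blast
    obtain m where m: "m \<in> Obj C" "\<And>P. thick_subcategory C P \<Longrightarrow> m \<in> P \<longleftrightarrow> k \<in> P \<and> k' \<in> P"
      using ex_thick_both[OF k(1) k'(1)] by metis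
    have "primes_over m = primes_over k \<inter> primes_over k'" using m(2)[OF prime_thick] by auto
    then show ?case using m(1) k k' by (intro bexI[of _ m]) auto
  next
    case (UN \<U>)
    then obtain V where V: "V \<in> \<U>" "P \<in> V" by blast
    then show ?case using UN.IH[OF V] by blast
  next
    case (Basis U)
    then obtain k where "k \<in> Obj C" "U = {P. prime_tt_ideal C P} - supp C k" by blast
    then show ?case using Basis.prems by (intro bexI[of _ k]) (auto simp: supp_def)
  qed
qed

text \<open>Finitely many basic sets cover \<open>U\<close>. By primality their union is represented
  by a tensor product, the empty union by the unit.\<close>

lemma Spc_compact_open:
  assumes U: "openin (Spc C) U" "compactin (Spc C) U"
  shows "\<exists>l \<in> Obj C. U = primes_over l"
proof -
  let ?\<U> = "primes_over ` {k \<in> Obj C. primes_over k \<subseteq> U}"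
  have "\<And>V. V \<in> ?\<U> \<Longrightarrow> openin (Spc C) V" using openin_primes_over by blast
  moreover have "U \<subseteq> \<Union>?\<U>" using Spc_nbhd[OF U(1)] by blast
  ultimately obtain \<F> where F: "finite \<F>" "\<F> \<subseteq> ?\<U>" "U \<subseteq> \<Union>\<F>"
    using U(2) unfolding compactin_def by meson
  have "\<exists>l \<in> Obj C. \<Union>\<F> = primes_over l" using F(1,2)
  proof (induction \<F> rule: finite_induct)
    case empty
    then show ?case using Unit_notin_prime Unit_closed by (intro bexI[of _ "Unit C"]) auto
  next
    case (insert V \<F>)
    obtain k where k: "k \<in> Obj C" "V = primes_over k" using insert.prems by blast
    obtain l where l: "l \<in> Obj C" "\<Union>\<F> = primes_over l" using insert by auto
    have "\<Union>(insert V \<F>) = primes_over (k \<otimes>\<^sub>o l)"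
      using k l prime_tensor_iff[OF _ k(1) l(1)] by auto
    then show ?case using TObj_closed k l by blast
  qed
  moreover have "\<Union>\<F> = U" using F by blast
  ultimately show ?thesis by simp
qed

text \<open>Differences of basic sets are stable under intersection: the objects \<open>k\<close>,
  \<open>k'\<close> are combined by \<open>ex_thick_both\<close>, the objects \<open>l\<close>,
  \<open>l'\<close> by the tensor product.\<close>

lemma patch_nbhd:
  assumes "openin (patch_topology (Spc C)) N" "P \<in> N"
  shows "\<exists>k \<in> Obj C. \<exists>l \<in> Obj C. P \<in> primes_over k - primes_over l \<and> primes_over k - primes_over l \<subseteq> N"
proof -
  let ?S = "{U. openin (Spc C) U \<and> compactin (Spc C) U}
    \<union> {topspace (Spc C) - U | U. openin (Spc C) U \<and> compactin (Spc C) U}"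
  have "generate_topology_on ?S N"
    using assms(1) by (simp add: patch_topology_def openin_topology_generated_by_iff)
  then show ?thesis using assms(2)
  proof (induction arbitrary: P rule: generate_topology_on.induct)
    case Empty
    then show ?case by simp
  next
    case (Int U V)
    obtain k l where k: "k \<in> Obj C" "l \<in> Obj C" "P \<in> primes_over k - primes_over l" "primes_over k - primes_over l \<subseteq> U"
      using Int.IH(1) Int.prems by blast
    obtain k' l' where k': "k' \<in> Obj C" "l' \<in> Obj C" "P \<in> primes_over k' - primes_over l'" "primes_over k' - primes_over l' \<subseteq> V"
      using Int.IH(2) Int.prems by blast
    obtain m where m: "m \<in> Obj C" "\<And>P. thick_subcategory C P \<Longrightarrow> m \<in> P \<longleftrightarrow> k \<in> P \<and> k' \<in> P"
      using ex_thick_both[OF k(1) k'(1)] by metis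
    have "primes_over m = primes_over k \<inter> primes_over k'" using m(2)[OF prime_thick] by auto
    moreover have "primes_over (l \<otimes>\<^sub>o l') = primes_over l \<union> primes_over l'"
      using prime_tensor_iff[OF _ k(2) k'(2)] by auto
    ultimately have "P \<in> primes_over m - primes_over (l \<otimes>\<^sub>o l')"
      "primes_over m - primes_over (l \<otimes>\<^sub>o l') \<subseteq> U \<inter> V"
      using k(3,4) k'(3,4) by blast+
    then show ?case using m(1) TObj_closed[OF k(2) k'(2)] by blast
  next
    case (UN \<U>)
    then obtain V where V: "V \<in> \<U>" "P \<in> V" by blast
    then show ?case using UN.IH[OF V] by blast
  next
    case (Basis N)
    then consider "openin (Spc C) N"
      | U where "openin (Spc C) U" "compactin (Spc C) U" "N = topspace (Spc C) - U" by blast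
    then show ?case
    proof cases
      case 1
      then obtain k where "k \<in> Obj C" "P \<in> primes_over k" "primes_over k \<subseteq> N" using Spc_nbhd Basis.prems by blast
      \<comment> \<open>No prime contains the unit, so subtracting
        \<open>primes_over (Unit C)\<close> removes nothing.\<close>
      then show ?thesis using Unit_notin_prime Unit_closed by (intro bexI[of _ k] bexI[of _ "Unit C"]) auto
    next
      case 2
      obtain l where l: "l \<in> Obj C" "U = primes_over l" using Spc_compact_open[OF 2(1,2)] by blast
      \<comment> \<open>With a zero object in the role of \<open>k\<close>,
        \<open>primes_over z\<close> is the whole spectrum.\<close>
      obtain z where z: "z \<in> Obj C" "\<And>P. prime_tt_ideal C P \<Longrightarrow> z \<in> P" using ex_zero_obj_in_primes by blast
      show ?thesis using 2(3) l z Basis.prems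
        by (intro bexI[of _ z] bexI[of _ l]) (auto simp: topspace_Spc)
    qed
  qed
qed

end


theorem corollary1p4:
  fixes K :: "('o, 'm) tt_cat"
    and I :: "'i set"
    and L :: "'i \<Rightarrow> ('p, 'n) tt_cat"
    and F :: "'i \<Rightarrow> ('o, 'm, 'p, 'n) monoidal_func"
  assumes "tt_category K" and "rigid K"
    and "\<And>i. i \<in> I \<Longrightarrow> tt_category (L i)"
    and "\<And>i. i \<in> I \<Longrightarrow> tt_functor K (L i) (F i)"
    and "jointly_detects_tensor_nilpotence I K L F"
  shows "patch_dense (Spc K) (\<Union>i\<in>I. Spc_map K (F i) ` topspace (Spc (L i)))"
proof -
  interpret tt_category K by fact
  let ?S = "\<Union>i\<in>I. Spc_map K (F i) ` topspace (Spc (L i))"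
  have top_L: "topspace (Spc (L i)) = {Q. prime_tt_ideal (L i) Q}" if "i \<in> I" for i
    using tt_category.topspace_Spc[OF assms(3)[OF that]] .
  have sub: "?S \<subseteq> topspace (Spc K)"
    using prime_Spc_map[OF assms(1) assms(3) assms(4)] top_L by (auto simp: topspace_Spc)
  have meets: "\<exists>Q \<in> ?S. Q \<in> N" if P: "P \<in> topspace (Spc K)" and N: "openin (patch_topology (Spc K)) N" "P \<in> N" for P N
  proof -
    obtain k l where kl: "k \<in> Obj K" "l \<in> Obj K" "P \<in> primes_over k - primes_over l" "primes_over k - primes_over l \<subseteq> N"
      using patch_nbhd[OF N] by blast
    obtain c y f where f: "c \<in> Obj K" "f \<in> Hom K (c \<otimes>\<^sub>o\<^bsub>K\<^esub> l) y" "zero_arr K (f \<otimes>\<^sub>a\<^bsub>K\<^esub> Id K k)"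
      "\<And>P. prime_tt_ideal K P \<Longrightarrow> k \<in> P \<Longrightarrow> tensor_nilpotent K f \<Longrightarrow> l \<in> P"
      using rigid_test_morphism[OF assms(2) kl(1,2)] by metis
    \<comment> \<open>\<open>P\<close> contains \<open>k\<close> but not \<open>l\<close>, which
      rules out nilpotence. Some functor of the family detects this, and the contrapositive of
      \<open>tt_functor_nilpotent\<close> yields a prime \<open>Q\<close> whose preimage lies in the
      neighbourhood.\<close>
    have "\<not> tensor_nilpotent K f" using f(4) kl(3) by blast
    then obtain i where i: "i \<in> I" "\<not> tensor_nilpotent (L i) (amap (F i) f)"
      using assms(5) HomD[OF f(2)] unfolding jointly_detects_tensor_nilpotence_def by blast
    then obtain Q where Q: "prime_tt_ideal (L i) Q" "omap (F i) k \<in> Q" "omap (F i) l \<notin> Q"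
      using tt_functor_nilpotent[OF assms(1) assms(3)[OF i(1)] assms(4)[OF i(1)] kl(1) f(1) kl(2) f(2,3)] by blast
    have pr: "prime_tt_ideal K (Spc_map K (F i) Q)"
      by (rule prime_Spc_map[OF assms(1) assms(3)[OF i(1)] assms(4)[OF i(1)] Q(1)])
    have "Spc_map K (F i) Q \<in> primes_over k - primes_over l" using Q pr kl(1) by (simp add: Spc_map_def)
    moreover have "Spc_map K (F i) Q \<in> ?S" using i(1) Q(1) top_L by blast
    ultimately show ?thesis using kl(4) by blast
  qed
  have "patch_topology (Spc K) closure_of ?S = topspace (Spc K)"
    unfolding closure_of_def topspace_patch_topology using meets by blast
  then show ?thesis using sub by (simp add: patch_dense_def)
qed

end
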